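(* Let $\Phi=\{\phi_i\}_{i\in\mathcal{D}}$ be a conformal iterated function system with self-conformal set $X\subset\mathbb{R}^d$, let $\gamma$ be the unique zero of the pressure $P$, let $T:X\to X$ be a map induced by the left shift, and let $\varphi:\mathbb{N}\to(0,\infty)$ be any function. Put $$R(T,\varphi)=\{x\in X:\ |T^nx-x|<\varphi(n)\text{ for infinitely many }n\in\mathbb{N}\}.$$ Let $\mathcal{H}^{\gamma}$ denote $\gamma$-dimensional Hausdorff measure. Then: 1. If $\sum_{n=1}^{\infty}\varphi(n)^{\gamma}<\infty$, then $\mathcal{H}^{\gamma}(R(T,\varphi))=0$. 2. If $\Phi$ satisfies the open set condition and $\sum_{n=1}^{\infty}\varphi(n)^{\gamma}=\infty$, then $\mathcal{H}^{\gamma}(R(T,\varphi))=\mathcal{H}^{\gamma}(X)$.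
   Context: Conformal iterated function system: for an open set $V\subset\mathbb{R}^d$, a $C^1$ map $\phi:V\to\mathbb{R}^d$ is conformal if $|\phi'(x)y|=|\phi'(x)||y|$ for all $x\in V$, $y\in\mathbb{R}^d$. A conformal iterated function system is a finite family $\Phi=\{\phi_i\}_{i\in\mathcal{D}}$ of maps $\phi_i:Y\to Y$ on a compact set $Y\subset\mathbb{R}^d$ such that there is $r\in(0,1)$ with $|\phi_i(x)-\phi_i(y)|\le r|x-y|$ for all $x,y\in Y$, $i\in\mathcal{D}$, and such that each $\phi_i$ extends to an injective conformal contraction $\phi_i:V\to V$ of some open connected set $V\supset Y$ (common to all $i$) with $0<\inf_{x\in V}|\phi_i'(x)|\le\sup_{x\in V}|\phi_i'(x)|<1$. Differentials are assumed Hölder continuous: there are $\alpha>0$, $c>0$ with $\big||\phi_i'(x)|-|\phi_i'(y)|\big|\le c|x-y|^{\alpha}$ for all $x,y\in V$, $i\in\mathcal{D}$. Self-conformal set: the unique non-empty compact $X\subset\mathbb{R}^d$ with $X=\bigcup_{i\in\mathcal{D}}\phi_i(X)$. Words: for $I=(i_1,\dots,i_n)\in\mathcal{D}^n$, $\phi_I=\phi_{i_1}\circ\cdots\circ\phi_{i_n}$ and $\|\phi_I'\|=\sup_{x\in V}|\phi_I'(x)|$. Pressure: $P(s)=\lim_{n\to\infty}\frac1n\log\sum_{I\in\mathcal{D}^n}\|\phi_I'\|^s$, and $\gamma$ is the unique number with $P(\gamma)=0$. Open set condition: there is a non-empty open set $O\subset\mathbb{R}^d$, contained in $V$, with $\phi_i(O)\subseteq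 O$ for all $i\in\mathcal{D}$ and $\phi_i(O)\cap\phi_j(O)=\emptyset$ for $i\ne j$. Coding and $T$: $\pi:\mathcal{D}^{\mathbb{N}}\to X$, $\pi((i_m))=\lim_{n\to\infty}(\phi_{i_1}\circ\cdots\circ\phi_{i_n})(y_0)$ for any $y_0\in Y$ (the limit does not depend on $y_0$); $\pi$ is surjective. A coding of $x\in X$ is a sequence $(i_m)$ with $\pi((i_m))=x$. For each $x\in X$ fix an arbitrary coding $(i_m)_{m\ge1}$ of $x$ and set $Tx=\pi((i_{m+1})_{m\ge1})$; $T^n$ is the $n$-th iterate of $T$. *)

theory Defs
  imports "HOL-Analysis.Analysis"
begin

section \<open>Conformal iterated function systems\<close>

definition deriv_norm :: "('a::euclidean_space \<Rightarrow> 'a) \<Rightarrow> 'a \<Rightarrow> real" where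
  "deriv_norm f x = onorm (frechet_derivative f (at x))"

definition C1_on :: "'a::euclidean_space set \<Rightarrow> ('a \<Rightarrow> 'a) \<Rightarrow> bool" where
  "C1_on V f \<longleftrightarrow> (\<exists>F :: 'a \<Rightarrow> 'a \<Rightarrow>\<^sub>L 'a.
     (\<forall>x\<in>V. (f has_derivative blinfun_apply (F x)) (at x)) \<and> continuous_on V F)"

definition conformal_on :: "'a::euclidean_space set \<Rightarrow> ('a \<Rightarrow> 'a) \<Rightarrow> bool" where
  "conformal_on V f \<longleftrightarrow> C1_on V f \<and>
     (\<forall>x\<in>V. \<forall>y. norm (frechet_derivative f (at x) y) = deriv_norm f x * norm y)"

definition contraction_on :: "'a::metric_space set \<Rightarrow> ('a \<Rightarrow> 'a) \<Rightarrow> bool" where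
  "contraction_on V f \<longleftrightarrow>
     (\<exists>r. 0 < r \<and> r < 1 \<and> (\<forall>x\<in>V. \<forall>y\<in>V. dist (f x) (f y) \<le> r * dist x y))"

text \<open>The same symbol \<open>\<phi> i\<close> denotes the map \<open>Y \<rightarrow> Y\<close> and its extension \<open>V \<rightarrow> V\<close>; values
  outside \<open>V\<close> play no role.  The explicit \<open>bdd_above\<close> is needed because \<open>Sup\<close> on the reals is
  unspecified for unbounded sets.\<close>

definition conformal_ifs ::
    "'i set \<Rightarrow> ('i \<Rightarrow> 'a::euclidean_space \<Rightarrow> 'a) \<Rightarrow> 'a set \<Rightarrow> 'a set \<Rightarrow> bool" where
  "conformal_ifs D \<phi> Y V \<longleftrightarrow>
     finite D \<and> compact Y \<and> open V \<and> connected V \<and> Y \<subseteq> V \<and>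
     (\<forall>i\<in>D. \<phi> i ` Y \<subseteq> Y) \<and>
     (\<exists>r. 0 < r \<and> r < 1 \<and>
        (\<forall>i\<in>D. \<forall>x\<in>Y. \<forall>y\<in>Y. norm (\<phi> i x - \<phi> i y) \<le> r * norm (x - y))) \<and>
     (\<forall>i\<in>D. \<phi> i ` V \<subseteq> V \<and> inj_on (\<phi> i) V \<and> conformal_on V (\<phi> i) \<and> contraction_on V (\<phi> i) \<and>
        bdd_above (deriv_norm (\<phi> i) ` V) \<and>
        0 < (INF x\<in>V. deriv_norm (\<phi> i) x) \<and> (SUP x\<in>V. deriv_norm (\<phi> i) x) < 1) \<and>
     (\<exists>\<alpha> c. 0 < \<alpha> \<and> 0 < c \<and>
        (\<forall>i\<in>D. \<forall>x\<in>V. \<forall>y\<in>V.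
           \<bar>deriv_norm (\<phi> i) x - deriv_norm (\<phi> i) y\<bar> \<le> c * norm (x - y) powr \<alpha>))"

text \<open>There is exactly one such \<open>X\<close> for a conformal iterated function system with \<open>Y\<close> and the
  index set non-empty (and none if either is empty).\<close>

definition self_conformal_set ::
    "'i set \<Rightarrow> ('i \<Rightarrow> 'a::euclidean_space \<Rightarrow> 'a) \<Rightarrow> 'a set \<Rightarrow> 'a set \<Rightarrow> bool" where
  "self_conformal_set D \<phi> Y X \<longleftrightarrow>
     X \<noteq> {} \<and> compact X \<and> X \<subseteq> Y \<and> X = (\<Union>i\<in>D. \<phi> i ` X)"

definition open_set_condition ::
    "'i set \<Rightarrow> ('i \<Rightarrow> 'a::euclidean_space \<Rightarrow> 'a) \<Rightarrow> 'a set \<Rightarrow> bool" where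
  "open_set_condition D \<phi> V \<longleftrightarrow>
     (\<exists>U. open U \<and> U \<noteq> {} \<and> U \<subseteq> V \<and> (\<forall>i\<in>D. \<phi> i ` U \<subseteq> U) \<and>
        (\<forall>i\<in>D. \<forall>j\<in>D. i \<noteq> j \<longrightarrow> \<phi> i ` U \<inter> \<phi> j ` U = {}))"


section \<open>Words and pressure\<close>

definition words :: "'i set \<Rightarrow> nat \<Rightarrow> 'i list set" where
  "words D n = {I. set I \<subseteq> D \<and> length I = n}"

definition word_map :: "('i \<Rightarrow> 'a \<Rightarrow> 'a) \<Rightarrow> 'i list \<Rightarrow> 'a \<Rightarrow> 'a" where
  "word_map \<phi> I = foldr (\<lambda>i g. \<phi> i \<circ> g) I id"

definition word_norm :: "('i \<Rightarrow> 'a::euclidean_space \<Rightarrow> 'a) \<Rightarrow> 'a set \<Rightarrow> 'i list \<Rightarrow> real" where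
  "word_norm \<phi> V I = (SUP x\<in>V. deriv_norm (word_map \<phi> I) x)"

definition pressure ::
    "'i set \<Rightarrow> ('i \<Rightarrow> 'a::euclidean_space \<Rightarrow> 'a) \<Rightarrow> 'a set \<Rightarrow> real \<Rightarrow> real" where
  "pressure D \<phi> V s = lim (\<lambda>n. 1 / real n * ln (\<Sum>I\<in>words D n. word_norm \<phi> V I powr s))"


section \<open>Codings and maps induced by the left shift\<close>

text \<open>Sequences are indexed from 0, so \<open>\<omega> m\<close> is the letter \<open>i\<^bsub>m+1\<^esub>\<close>.\<close>

definition coding_map ::
    "('i \<Rightarrow> 'a::euclidean_space \<Rightarrow> 'a) \<Rightarrow> 'a set \<Rightarrow> (nat \<Rightarrow> 'i) \<Rightarrow> 'a" where
  "coding_map \<phi> Y \<omega> = (THE x. \<forall>y\<in>Y. (\<lambda>n. word_map \<phi> (map \<omega> [0..<n]) y) \<longlonglongrightarrow> x)"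

definition is_coding ::
    "'i set \<Rightarrow> ('i \<Rightarrow> 'a::euclidean_space \<Rightarrow> 'a) \<Rightarrow> 'a set \<Rightarrow> (nat \<Rightarrow> 'i) \<Rightarrow> 'a \<Rightarrow> bool" where
  "is_coding D \<phi> Y \<omega> x \<longleftrightarrow> (\<forall>m. \<omega> m \<in> D) \<and> coding_map \<phi> Y \<omega> = x"

definition induced_by_shift ::
    "'i set \<Rightarrow> ('i \<Rightarrow> 'a::euclidean_space \<Rightarrow> 'a) \<Rightarrow> 'a set \<Rightarrow> 'a set \<Rightarrow> ('a \<Rightarrow> 'a) \<Rightarrow> bool" where
  "induced_by_shift D \<phi> Y X T \<longleftrightarrow>
     (\<exists>\<kappa>. \<forall>x\<in>X. is_coding D \<phi> Y (\<kappa> x) x \<and> T x = coding_map \<phi> Y (\<lambda>m. \<kappa> x (Suc m)))"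

definition recurrence_set ::
    "'a::euclidean_space set \<Rightarrow> ('a \<Rightarrow> 'a) \<Rightarrow> (nat \<Rightarrow> real) \<Rightarrow> 'a set" where
  "recurrence_set X T \<psi> = {x\<in>X. infinite {n. n \<ge> 1 \<and> norm ((T ^^ n) x - x) < \<psi> n}}"


section \<open>Hausdorff measure\<close>

text \<open>The conventions are \<open>diam {} ^ s = 0\<close> and, for non-empty \<open>U\<close>, \<open>diam U ^ 0 = 1\<close>, so that
  the 0-dimensional measure is counting measure; \<open>powr\<close> alone would give \<open>0 powr 0 = 0\<close>.
  The covering sets are required to be bounded because \<^const>\<open>diameter\<close> is unspecified
  otherwise.\<close>

definition diam_power :: "real \<Rightarrow> 'a::metric_space set \<Rightarrow> ennreal" where
  "diam_power s U =
     (if U = {} then 0 else if s = 0 then 1 else ennreal (diameter U powr s))"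

definition hausdorff_content :: "real \<Rightarrow> real \<Rightarrow> 'a::metric_space set \<Rightarrow> ennreal" where
  "hausdorff_content \<delta> s A =
     Inf {(\<Sum>k. diam_power s (U k)) | U :: nat \<Rightarrow> 'a set.
            A \<subseteq> (\<Union>k. U k) \<and> (\<forall>k. bounded (U k) \<and> diameter (U k) \<le> \<delta>)}"

definition hausdorff_measure :: "real \<Rightarrow> 'a::metric_space set \<Rightarrow> ennreal" where
  "hausdorff_measure s A = (SUP \<delta>\<in>{0<..}. hausdorff_content \<delta> s A)"

end

theory Submission
  imports Defs
begin

text \<open>Along an orbit of \<open>T\<close> the first letters of the chosen codings form a coding on which \<open>T\<close> acts
  as the shift, so \<open>x = \<phi>\<^sub>I (T\<^sup>n x)\<close> for a word \<open>I\<close> of length \<open>n\<close>.  Bounded distortion makes the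
  weights \<open>\<bar>\<phi>\<^sub>I'(x\<^sub>0)\<bar>\<^sup>\<gamma>\<close> quasi-multiplicative, and the vanishing of the pressure bounds their
  sum over the words of length \<open>n\<close> independently of \<open>n\<close>.  In the convergence case the points
  \<open>\<phi>\<^sub>I z\<close> with \<open>\<bar>z - \<phi>\<^sub>I z\<bar> < \<psi> n\<close> form a set of diameter at most a constant times
  \<open>\<bar>\<phi>\<^sub>I'(x\<^sub>0)\<bar> \<psi> n\<close>, and Borel--Cantelli applies.

  In the divergence case either the sums become small, so that \<open>X\<close> itself is null, or they are
  bounded away from zero.  Then \<open>\<bar>T\<^sup>n x - x\<bar> < \<psi> n\<close> as soon as the coding of \<open>x\<close>, shifted by \<open>n\<close>,
  starts with that prefix of the coding which first has weight at most \<open>p n\<close>, where \<open>p n\<close> is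
  comparable to \<open>min 1 (\<psi> n\<^sup>\<gamma>)\<close>.  These events are quasi-independent, and a second moment
  estimate shows that a fixed proportion of every cylinder is hit.  Iterating over finitely many
  levels, the cylinders that are never hit have arbitrarily small total weight, and they cover
  the points of \<open>X\<close> that are not recurrent.\<close>

section \<open>Quasi-multiplicative weights on words\<close>

text \<open>The obstacle is a lower bound for the level sums. Subadditivity bounds the sums of
  \<open>word_norm\<close> from below, but \<open>word_norm\<close> is a supremum over V, which may
  be unbounded, whereas bounded distortion compares points at bounded distance only. The weights are
  therefore taken at a point of X. There zero pressure still gives the upper bound: one level sum
  above \<open>K powr \<gamma>\<close> would force exponential growth. In place of a lower bound
  there is a dichotomy, since one level sum below the reciprocal of that constant already forces
  geometric decay.

  A hit compares the letters after position n with a prefix that must be known by then. Hence only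
  those n are used for which the prefix surely ends within n letters; the discarded n carry a
  convergent geometric series. The exponent \<gamma> = 0, where the weights do not decay, is treated
  separately.\<close>

lemma wordsD: "w \<in> words D n \<Longrightarrow> length w = n" "w \<in> words D n \<Longrightarrow> set w \<subseteq> D"
  by (auto simp: words_def)

lemma finite_words: "finite D \<Longrightarrow> finite (words D n)"
  unfolding words_def by (rule finite_lists_length_eq)

lemma words_0 [simp]: "words D 0 = {[]}"
  by (auto simp: words_def)

lemma words_append: "I \<in> words D m \<Longrightarrow> J \<in> words D n \<Longrightarrow> I @ J \<in> words D (m + n)"
  by (auto simp: words_def)

lemma words_take: "w \<in> words D n \<Longrightarrow> k \<le> n \<Longrightarrow> take k w \<in> words D k"
  by (auto simp: words_def dest: in_set_takeD)

lemma words_drop: "w \<in> words D (m + n) \<Longrightarrow> drop m w \<in> words D n"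
  by (auto simp: words_def dest: in_set_dropD)

lemma sum_words_add:
  assumes "finite D"
  shows "(\<Sum>w\<in>words D (m + n). f w) = (\<Sum>I\<in>words D m. \<Sum>J\<in>words D n. f (I @ J))"
proof -
  have "(\<Sum>I\<in>words D m. \<Sum>J\<in>words D n. f (I @ J)) = (\<Sum>(I, J)\<in>words D m \<times> words D n. f (I @ J))"
    by (rule sum.cartesian_product)
  also have "\<dots> = (\<Sum>w\<in>words D (m + n). f w)"
    by (rule sum.reindex_bij_witness[where j = "\<lambda>(I, J). I @ J" and i = "\<lambda>w. (take m w, drop m w)"])
      (auto simp: words_append words_take words_drop wordsD)
  finally show ?thesis ..
qed

text \<open>If N counts the events that occur, then 1 - (1 - t * N)^2 is at most the indicator of N
  > 0: it vanishes at N = 0 and never exceeds one. Summing against q gives the bound. Leaving t free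
  avoids Cauchy--Schwarz and a division by the second moment.\<close>

lemma second_moment:
  fixes q :: "'a \<Rightarrow> real" and t :: real
  assumes "finite W" "finite F" and q: "\<And>w. w \<in> W \<Longrightarrow> 0 \<le> q w"
  shows "2 * t * (\<Sum>n\<in>F. sum q {w\<in>W. E n w})
      - t\<^sup>2 * (\<Sum>n\<in>F. \<Sum>m\<in>F. sum q {w\<in>W. E n w \<and> E m w})
    \<le> sum q {w\<in>W. \<exists>n\<in>F. E n w}"
proof -
  define N where "N w = (\<Sum>n\<in>F. of_bool (E n w) :: real)" for w
  have sumq: "sum q {w\<in>W. P w} = (\<Sum>w\<in>W. q w * of_bool (P w))" for P
    using assms(1) by (simp add: sum.inter_filter of_bool_def if_distrib cong: if_cong)
  have A: "(\<Sum>n\<in>F. sum q {w\<in>W. E n w}) = (\<Sum>w\<in>W. q w * N w)"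
    unfolding sumq N_def sum_distrib_left by (rule sum.swap)
  have "(\<Sum>n\<in>F. \<Sum>m\<in>F. sum q {w\<in>W. E n w \<and> E m w})
      = (\<Sum>n\<in>F. \<Sum>w\<in>W. \<Sum>m\<in>F. q w * of_bool (E n w \<and> E m w))"
    unfolding sumq by (rule sum.cong[OF refl], rule sum.swap)
  also have "\<dots> = (\<Sum>w\<in>W. \<Sum>n\<in>F. \<Sum>m\<in>F. q w * of_bool (E n w \<and> E m w))"
    by (rule sum.swap)
  also have "\<dots> = (\<Sum>w\<in>W. q w * (N w)\<^sup>2)"
    unfolding N_def power2_eq_square sum_product of_bool_conj sum_distrib_left[symmetric] ..
  finally have B: "(\<Sum>n\<in>F. \<Sum>m\<in>F. sum q {w\<in>W. E n w \<and> E m w}) = (\<Sum>w\<in>W. q w * (N w)\<^sup>2)" .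
  have pt: "2 * t * N w - t\<^sup>2 * (N w)\<^sup>2 \<le> of_bool (\<exists>n\<in>F. E n w)" for w
  proof (cases "\<exists>n\<in>F. E n w")
    case True
    have "0 \<le> (1 - t * N w)\<^sup>2" by simp
    then show ?thesis using True by (simp add: power2_eq_square algebra_simps)
  next
    case False
    then have "N w = 0" unfolding N_def by (intro sum.neutral) auto
    then show ?thesis by simp
  qed
  have "2 * t * (\<Sum>w\<in>W. q w * N w) - t\<^sup>2 * (\<Sum>w\<in>W. q w * (N w)\<^sup>2)
      = (\<Sum>w\<in>W. q w * (2 * t * N w - t\<^sup>2 * (N w)\<^sup>2))"
    by (simp add: sum_distrib_left sum_subtractf[symmetric] algebra_simps)
  also have "\<dots> \<le> (\<Sum>w\<in>W. q w * of_bool (\<exists>n\<in>F. E n w))"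
    by (intro sum_mono mult_left_mono pt q)
  finally show ?thesis unfolding A B sumq[of "\<lambda>w. \<exists>n\<in>F. E n w"] by simp
qed

section \<open>Cylinders and their masses at a deep level\<close>

definition cyl :: "'i set \<Rightarrow> nat \<Rightarrow> 'i list \<Rightarrow> 'i list set" where
  "cyl D L I = {w \<in> words D L. take (length I) w = I}"

lemma finite_cyl: "finite D \<Longrightarrow> finite (cyl D L I)"
  by (simp add: cyl_def finite_words)

lemma cyl_words: "w \<in> cyl D L I \<Longrightarrow> w \<in> words D L"
  by (simp add: cyl_def)

lemma cyl_Nil [simp]: "cyl D L [] = words D L"
  by (simp add: cyl_def)

lemma sum_cyl_split:
  assumes "finite D" "length u \<le> n" "n \<le> L"
  shows "(\<Sum>w\<in>cyl D L u. f w) = (\<Sum>I\<in>cyl D n u. \<Sum>w\<in>cyl D L I. f w)"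
proof -
  have "take n ` cyl D L u \<subseteq> cyl D n u"
    using assms by (auto simp: cyl_def words_take min_def)
  then have "(\<Sum>I\<in>cyl D n u. \<Sum>w\<in>{w \<in> cyl D L u. take n w = I}. f w) = (\<Sum>w\<in>cyl D L u. f w)"
    by (intro sum.group finite_cyl assms)
  moreover have "{w \<in> cyl D L u. take n w = I} = cyl D L I" if "I \<in> cyl D n u" for I
    using that assms by (auto simp: cyl_def wordsD min_def dest: arg_cong[of _ _ "take (length u)"])
  ultimately show ?thesis by simp
qed

text \<open>Weights on finite words that are multiplicative up to the factor \<open>K\<close> and whose total mass
  on each level is comparable to one.  Keeping the words finite makes a Gibbs measure on the
  sequence space unnecessary: the weights on a sufficiently deep level \<open>L\<close> play its role.\<close>

locale gibbs_words =
  fixes D :: "'i set" and q :: "'i list \<Rightarrow> real" and K B \<theta> \<eta> :: real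
  assumes finite_D: "finite D"
    and q_Nil: "q [] = 1"
    and q_pos: "set I \<subseteq> D \<Longrightarrow> 0 < q I"
    and q_upper: "set I \<subseteq> D \<Longrightarrow> set J \<subseteq> D \<Longrightarrow> q (I @ J) \<le> K * q I * q J"
    and q_lower: "set I \<subseteq> D \<Longrightarrow> set J \<subseteq> D \<Longrightarrow> q I * q J \<le> K * q (I @ J)"
    and q_decay: "set I \<subseteq> D \<Longrightarrow> q I \<le> \<theta> ^ length I"
    and theta: "0 < \<theta>" "\<theta> < 1"
    and eta: "0 < \<eta>" "i \<in> D \<Longrightarrow> \<eta> \<le> q [i]"
    and K: "1 \<le> K" and B: "1 \<le> B"
    and mass_upper: "(\<Sum>I\<in>words D n. q I) \<le> B"
    and mass_lower: "1 \<le> B * (\<Sum>I\<in>words D n. q I)"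
begin

text \<open>Origin: two exchanges of mass for weight at K * B each, and one splitting of a weight at
  K, in \<open>cyl_mass_append\<close>.\<close>

abbreviation "C1 \<equiv> K ^ 3 * B ^ 2"

lemma cyl_mass_eq:
  assumes "I \<in> words D n" "n \<le> L"
  shows "sum q (cyl D L I) = (\<Sum>J\<in>words D (L - n). q (I @ J))"
proof (rule sum.reindex_bij_witness[where i = "\<lambda>J. I @ J" and j = "drop n"])
  fix w assume w: "w \<in> cyl D L I"
  then show "I @ drop n w = w" using assms by (metis (mono_tags, lifting) append_take_drop_id cyl_def mem_Collect_eq wordsD(1))
  show "drop n w \<in> words D (L - n)"
    using w assms by (intro words_drop) (auto simp: cyl_def)
  then show "q (I @ drop n w) = q w" using \<open>I @ drop n w = w\<close> by simp
next
  fix J assume "J \<in> words D (L - n)"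
  then show "drop n (I @ J) = J" "I @ J \<in> cyl D L I"
    using assms words_append[of I D n J "L - n"] by (auto simp: cyl_def wordsD)
qed

text \<open>Splitting q (I @ J) pulls q I out at the price of K, and what remains is the total over
  a full level, which B controls. The bounds do not depend on L, so the level can be chosen as deep
  as needed.\<close>

lemma cyl_mass:
  assumes "I \<in> words D n" "n \<le> L"
  shows "sum q (cyl D L I) \<le> K * B * q I" "q I \<le> K * B * sum q (cyl D L I)"
proof -
  have I: "set I \<subseteq> D" using assms by (simp add: wordsD)
  have "sum q (cyl D L I) \<le> (\<Sum>J\<in>words D (L - n). K * q I * q J)"
    unfolding cyl_mass_eq[OF assms] by (intro sum_mono q_upper I) (simp add: wordsD)
  also have "\<dots> = K * q I * (\<Sum>J\<in>words D (L - n). q J)" by (simp add: sum_distrib_left)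
  also have "\<dots> \<le> K * q I * B"
    using K q_pos[OF I] by (intro mult_left_mono mass_upper) auto
  finally show "sum q (cyl D L I) \<le> K * B * q I" by (simp add: mult_ac)
  have "q I * 1 \<le> q I * (B * (\<Sum>J\<in>words D (L - n). q J))"
    using q_pos[OF I] by (intro mult_left_mono mass_lower) auto
  also have "\<dots> = B * (\<Sum>J\<in>words D (L - n). q I * q J)" by (simp add: sum_distrib_left mult_ac)
  also have "\<dots> \<le> B * (\<Sum>J\<in>words D (L - n). K * q (I @ J))"
    using B by (intro mult_left_mono sum_mono q_lower I) (auto simp: wordsD)
  also have "\<dots> = K * B * sum q (cyl D L I)"
    unfolding cyl_mass_eq[OF assms] by (simp add: sum_distrib_left mult_ac)
  finally show "q I \<le> K * B * sum q (cyl D L I)" by simp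
qed

lemma q_nonneg: "w \<in> words D n \<Longrightarrow> 0 \<le> q w"
  using q_pos[of w] by (simp add: wordsD less_imp_le)

lemma cyl_mass_nonneg: "0 \<le> sum q (cyl D L I)"
  by (intro sum_nonneg) (auto simp: cyl_def q_nonneg)

text \<open>The Gibbs property for masses: after the prefix I, the block J has conditional mass q J
  up to \<open>C1\<close>, whatever I is. This near independence of the past drives the later
  estimates.\<close>

lemma cyl_mass_append:
  assumes I: "I \<in> words D n" and J: "J \<in> words D k" and L: "n + k \<le> L"
  shows "sum q (cyl D L (I @ J)) \<le> C1 * q J * sum q (cyl D L I)"
    and "q J * sum q (cyl D L I) \<le> C1 * sum q (cyl D L (I @ J))"
proof -
  have IJ: "I @ J \<in> words D (n + k)" using I J by (rule words_append)
  have s: "set I \<subseteq> D" "set J \<subseteq> D" using I J by (auto simp: wordsD)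
  note pos = q_pos[OF s(1)] q_pos[OF s(2)]
  have "sum q (cyl D L (I @ J)) \<le> K * B * q (I @ J)" by (rule cyl_mass(1)[OF IJ L])
  also have "\<dots> \<le> K * B * (K * q I * q J)"
    using K B by (intro mult_left_mono q_upper s) auto
  also have "\<dots> = (K * B * K * q J) * q I" by simp
  also have "\<dots> \<le> (K * B * K * q J) * (K * B * sum q (cyl D L I))"
    using K B pos L by (intro mult_left_mono cyl_mass(2)[OF I]) auto
  finally show "sum q (cyl D L (I @ J)) \<le> C1 * q J * sum q (cyl D L I)"
    by (simp add: power2_eq_square power3_eq_cube mult_ac)
  have "q J * sum q (cyl D L I) \<le> q J * (K * B * q I)"
    using pos L by (intro mult_left_mono cyl_mass(1)[OF I]) auto
  also have "\<dots> = K * B * (q I * q J)" by simp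
  also have "\<dots> \<le> K * B * (K * q (I @ J))"
    using K B by (intro mult_left_mono q_lower s) auto
  also have "\<dots> = K * B * K * q (I @ J)" by simp
  also have "\<dots> \<le> K * B * K * (K * B * sum q (cyl D L (I @ J)))"
    using K B by (intro mult_left_mono cyl_mass(2)[OF IJ L]) auto
  finally show "q J * sum q (cyl D L I) \<le> C1 * sum q (cyl D L (I @ J))"
    by (simp add: power2_eq_square power3_eq_cube mult_ac)
qed

section \<open>Stopping prefixes and hits\<close>

definition stop :: "real \<Rightarrow> 'i list \<Rightarrow> 'i list" where
  "stop p w = take (LEAST k. q (take k w) \<le> p) w"

text \<open>The decay of the weights makes n a witness for the \<open>LEAST\<close> in
  \<open>stop\<close>; without a witness its value would be arbitrary. By minimality the prefix one
  letter shorter still weighs more than p, and the last letter loses at most the factor \<eta> / K.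
  Since the search ends within n letters, it sees only \<open>take n w\<close>.\<close>

lemma stop:
  assumes w: "w \<in> words D L" and nL: "n \<le> L" and p: "0 < p" "p \<le> 1" and np: "\<theta> ^ n \<le> p"
  shows "length (stop p w) \<le> n" "stop p w = take (length (stop p w)) w"
    "stop p w \<in> words D (length (stop p w))"
    "q (stop p w) \<le> p" "\<eta> * p \<le> K * q (stop p w)" "stop p (take n w) = stop p w"
proof -
  define k where "k = (LEAST k. q (take k w) \<le> p)"
  have tn: "take n w \<in> words D n" using w nL by (rule words_take)
  have Pn: "q (take n w) \<le> p"
    using q_decay[of "take n w"] np wordsD[OF tn] by simp
  then have kn: "k \<le> n" unfolding k_def by (rule Least_le)
  have Pk: "q (take k w) \<le> p" unfolding k_def using Pn by (rule LeastI)
  have len: "length (stop p w) = k" using kn nL w by (simp add: stop_def k_def[symmetric] wordsD)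
  have st: "stop p w = take k w" by (simp add: stop_def k_def)
  show "length (stop p w) \<le> n" using len kn by simp
  show "stop p w = take (length (stop p w)) w" using len st by simp
  show "stop p w \<in> words D (length (stop p w))"
    unfolding len unfolding st using kn nL by (intro words_take[OF w]) auto
  show "q (stop p w) \<le> p" using Pk st by simp
  show "\<eta> * p \<le> K * q (stop p w)"
  proof (cases k)
    \<comment> \<open>The empty prefix weighs one, so p = 1 here and the claim becomes \<eta> \<le>
      K; a single letter gives \<eta> \<le> 1. For empty w the letter must come from D, which is
      non-empty because level 1 has positive mass.\<close>
    case 0
    then have "1 \<le> p" using Pk q_Nil by simp
    then have p1: "p = 1" using p by simp
    show ?thesis
    proof (cases "w = []")
      case True
      have "\<eta> \<le> 1" if "i \<in> D" for i
        using eta(2)[OF that] q_decay[of "[i]"] theta that by auto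
      moreover have "D \<noteq> {}"
      proof
        assume "D = {}"
        then have "words D 1 = {}" by (auto simp: words_def)
        then show False using mass_lower[of 1] by simp
      qed
      ultimately have "\<eta> \<le> 1" by auto
      then show ?thesis using p1 0 st q_Nil K by simp
    next
      case False
      then obtain i where i: "i \<in> D" using wordsD(2)[OF w] by (cases w) auto
      have "\<eta> \<le> 1"
        using eta(2)[OF i] q_decay[of "[i]"] theta i by auto
      then show ?thesis using p1 0 st q_Nil K by simp
    qed
  next
    case (Suc j)
    have jl: "j < length w" using Suc kn nL w by (simp add: wordsD)
    have "\<not> q (take j w) \<le> p" using Suc not_less_Least[of j "\<lambda>k. q (take k w) \<le> p"] by (simp add: k_def)
    then have jp: "p < q (take j w)" by simp
    have sj: "set (take j w) \<subseteq> D" using wordsD(2)[OF w] by (auto dest: in_set_takeD)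
    have wj: "w ! j \<in> D" using wordsD(2)[OF w] jl by auto
    have "\<eta> * p \<le> q [w ! j] * q (take j w)"
      using eta(1) eta(2)[OF wj] jp p by (intro mult_mono) auto
    also have "\<dots> \<le> K * q (take j w @ [w ! j])"
      using q_lower[OF sj, of "[w ! j]"] wj by (simp add: mult.commute)
    also have "take j w @ [w ! j] = stop p w"
      using jl Suc st by (simp add: take_Suc_conv_app_nth)
    finally show ?thesis .
  qed
  have "(LEAST k. q (take k (take n w)) \<le> p) = k"
  proof (rule Least_equality)
    show "q (take k (take n w)) \<le> p" using kn Pk by (simp add: min_def)
    fix y assume y: "q (take y (take n w)) \<le> p"
    show "k \<le> y"
    proof (cases "y \<le> n")
      case True
      then show ?thesis using y unfolding k_def by (intro Least_le) (simp add: min_def)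
    qed (use kn in simp)
  qed
  then show "stop p (take n w) = stop p w"
    using kn st by (simp add: stop_def min_def)
qed

text \<open>If w codes x and n is admissible, a hit puts x and its n-th image into the same cylinder
  of weight at most \<open>p n\<close>. The target moves with w, unlike in a shrinking target
  problem.\<close>

definition hit :: "(nat \<Rightarrow> real) \<Rightarrow> nat \<Rightarrow> 'i list \<Rightarrow> bool" where
  "hit p n w \<longleftrightarrow> take (length (stop (p n) w)) (drop n w) = stop (p n) w"

text \<open>For these n the stopping prefix ends within the first n letters, so the target is fixed
  by letters that precede the block compared with it.\<close>

definition admissible :: "(nat \<Rightarrow> real) \<Rightarrow> nat set" where
  "admissible p = {n. \<theta> ^ n \<le> p n}"

lemma sum_cyl_filter_split:
  assumes "length u \<le> n" "n \<le> L"
  shows "sum q {w \<in> cyl D L u. P w} = (\<Sum>I\<in>cyl D n u. sum q {w \<in> cyl D L I. P w})"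
proof -
  have "sum q {w \<in> cyl D L J. P w} = (\<Sum>w\<in>cyl D L J. if P w then q w else 0)" for J
    by (intro sum.inter_filter finite_cyl finite_D)
  then show ?thesis using sum_cyl_split[OF finite_D assms] by simp
qed

text \<open>Controls the overlap terms of \<open>joint_hit_mass\<close>, summed over the earlier
  time: distinct n give distinct gaps, hence part of a geometric series.\<close>

lemma sum_power_diff_le:
  assumes "finite F"
  shows "(\<Sum>n\<in>F. of_bool (n < m) * \<theta> ^ (m - n)) \<le> 1 / (1 - \<theta>)"
proof -
  have "(\<Sum>n\<in>F. of_bool (n < m) * \<theta> ^ (m - n)) = (\<Sum>n\<in>{n\<in>F. n < m}. \<theta> ^ (m - n))"
    unfolding sum.inter_filter[OF assms] by (intro sum.cong) auto
  also have "\<dots> = (\<Sum>k\<in>(\<lambda>n. m - n) ` {n\<in>F. n < m}. \<theta> ^ k)"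
    by (subst sum.reindex) (auto simp: inj_on_def)
  also have "\<dots> \<le> (\<Sum>k. \<theta> ^ k)"
    using theta assms by (intro sum_le_suminf) auto
  also have "\<dots> = 1 / (1 - \<theta>)" using theta by (intro suminf_geometric) auto
  finally show ?thesis .
qed

context
  fixes p :: "nat \<Rightarrow> real"
  assumes p01: "\<And>n. 0 < p n" "\<And>n. p n \<le> 1"
begin

text \<open>Fixing the first n letters fixes the moving target, so the event turns into a single
  cylinder.\<close>

lemma hit_cyl:
  assumes n: "n \<in> admissible p" "2 * n \<le> L" and I: "I \<in> words D n"
  shows "{w \<in> cyl D L I. hit p n w} = cyl D L (I @ stop (p n) I)"
proof -
  let ?s = "stop (p n) I"
  have np: "\<theta> ^ n \<le> p n" using n by (simp add: admissible_def)
  have nL: "n \<le> L" using n by simp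
  have lI: "length I = n" using I by (simp add: wordsD)
  have *: "hit p n w \<longleftrightarrow> take (length (I @ ?s)) w = I @ ?s" if "w \<in> words D L" "take n w = I" for w
  proof -
    have "stop (p n) w = ?s" using stop(6)[OF that(1) nL p01 np] that(2) by simp
    then show ?thesis using lI that(2) by (simp add: hit_def take_add)
  qed
  have **: "take n w = I" if "take (length (I @ ?s)) w = I @ ?s" for w
    using that lI by (metis append_eq_conv_conj length_append min.absorb2 min.commute le_add1 take_take)
  show ?thesis
    using * ** by (auto simp: cyl_def lI simp del: length_append)
qed

text \<open>Condition on the first n letters: the hit is then one block, of weight between \<eta> *
  p n / K and p n, and \<open>cyl_mass_append\<close> applies. The condition 2 * n \<le> L leaves
  room for that block.\<close>

lemma hit_mass:
  assumes n: "n \<in> admissible p" "2 * n \<le> L" and u: "length u \<le> n"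
  shows "sum q {w \<in> cyl D L u. hit p n w} \<le> C1 * p n * sum q (cyl D L u)" (is ?A)
    and "\<eta> * p n * sum q (cyl D L u) \<le> K * C1 * sum q {w \<in> cyl D L u. hit p n w}" (is ?B)
proof -
  have np: "\<theta> ^ n \<le> p n" using n by (simp add: admissible_def)
  have nL: "n \<le> L" using n by simp
  have C: "0 \<le> C1" "0 \<le> K" using K B by auto
  have *: "sum q {w \<in> cyl D L I. hit p n w} \<le> C1 * p n * sum q (cyl D L I)"
    "\<eta> * p n * sum q (cyl D L I) \<le> K * C1 * sum q {w \<in> cyl D L I. hit p n w}"
    if "I \<in> cyl D n u" for I
  proof -
    let ?s = "stop (p n) I"
    have I: "I \<in> words D n" using that by (rule cyl_words)
    note st = stop[OF I order_refl p01 np]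
    have len: "n + length ?s \<le> L" using st(1) n by simp
    have "sum q (cyl D L (I @ ?s)) \<le> C1 * q ?s * sum q (cyl D L I)"
      by (rule cyl_mass_append(1)[OF I st(3) len])
    also have "\<dots> \<le> C1 * p n * sum q (cyl D L I)"
      using C st(4) by (intro mult_right_mono mult_left_mono cyl_mass_nonneg) auto
    finally show "sum q {w \<in> cyl D L I. hit p n w} \<le> C1 * p n * sum q (cyl D L I)"
      unfolding hit_cyl[OF n I] .
    have "\<eta> * p n * sum q (cyl D L I) \<le> K * q ?s * sum q (cyl D L I)"
      by (intro mult_right_mono cyl_mass_nonneg st)
    also have "\<dots> = K * (q ?s * sum q (cyl D L I))" by simp
    also have "\<dots> \<le> K * (C1 * sum q (cyl D L (I @ ?s)))"
      by (intro mult_left_mono cyl_mass_append(2)[OF I st(3) len] C)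
    finally show "\<eta> * p n * sum q (cyl D L I) \<le> K * C1 * sum q {w \<in> cyl D L I. hit p n w}"
      unfolding hit_cyl[OF n I] by simp
  qed
  show ?A unfolding sum_cyl_filter_split[OF u nL] sum_cyl_split[OF finite_D u nL] sum_distrib_left[of _ _ "cyl D n u"]
    by (rule sum_mono[OF *(1)])
  show ?B unfolding sum_cyl_filter_split[OF u nL] sum_cyl_split[OF finite_D u nL] sum_distrib_left[of _ _ "cyl D n u"]
    by (rule sum_mono[OF *(2)])
qed

text \<open>If \<open>w\<close> is hit at both times, then \<open>drop n w\<close> starts with the first \<open>m - n\<close> letters of its
  stopping prefix (or with all of it), which is decided by the first \<open>m\<close> letters; the hit at time
  \<open>m\<close> then costs a further factor \<open>p m\<close>.\<close>

lemma joint_hit_mass: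
  assumes n: "n \<in> admissible p" and m: "m \<in> admissible p" "2 * m \<le> L"
    and nm: "n < m" and u: "length u \<le> n"
  shows "sum q {w \<in> cyl D L u. hit p n w \<and> hit p m w}
    \<le> C1\<^sup>2 * p m * (p n + \<theta> ^ (m - n)) * sum q (cyl D L u)"
proof -
  have np: "\<theta> ^ n \<le> p n" using n by (simp add: admissible_def)
  have nL: "n \<le> L" "m \<le> L" "n \<le> m" and um: "length u \<le> m" using m nm u by simp_all
  have C: "0 \<le> C1" using K B by auto
  define pre where "pre I = I @ take (m - n) (stop (p n) I)" for I
  \<comment> \<open>A necessary condition for a hit at time n. The truncation keeps it before
    position m, apart from the block tested at time m.\<close>
  define good where "good I \<longleftrightarrow> take (length (pre (take n I))) I = pre (take n I)" for I
  have 1: "sum q {w \<in> cyl D L I. hit p n w \<and> hit p m w} \<le> (if good I then C1 * p m * sum q (cyl D L I) else 0)"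
    if "I \<in> cyl D m u" for I
  proof (cases "\<exists>w\<in>cyl D L I. hit p n w")
    case True
    then obtain w where w: "w \<in> cyl D L I" "hit p n w" by blast
    have I: "I \<in> words D m" using that by (rule cyl_words)
    have wI: "take m w = I" using w I by (auto simp: cyl_def wordsD)
    have w': "w \<in> words D L" using w by (simp add: cyl_def)
    have tI: "take n I = take n w" using wI nm by auto
    have st: "stop (p n) (take n I) = stop (p n) w"
      unfolding tI by (rule stop(6)[OF w' nL(1) p01 np])
    let ?s = "stop (p n) w"
    have h: "take (length ?s) (drop n w) = ?s" using w(2) by (simp add: hit_def)
    have "good I"
    proof -
      have ln: "length (take n w) = n" using w' nL by (simp add: wordsD)
      have "take (n + min (length ?s) (m - n)) I = take (n + min (length ?s) (m - n)) w"
        unfolding wI[symmetric] using nm by (simp add: min_def)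
      also have "\<dots> = take n w @ take (min (length ?s) (m - n)) (drop n w)" by (simp add: take_add)
      also have "take (min (length ?s) (m - n)) (drop n w) = take (m - n) ?s"
        by (subst h[symmetric]) (simp add: min.commute)
      finally show ?thesis
        unfolding good_def pre_def st by (simp add: tI ln length_take[of _ "stop (p n) w"] del: length_take)

    qed
    have "sum q {w \<in> cyl D L I. hit p n w \<and> hit p m w} \<le> sum q {w \<in> cyl D L I. hit p m w}"
      by (rule sum_mono2) (auto simp: finite_cyl finite_D intro: q_nonneg cyl_words)
    also have "\<dots> \<le> C1 * p m * sum q (cyl D L I)"
      using I by (intro hit_mass m) (simp add: wordsD)
    finally show ?thesis using \<open>good I\<close> by simp
  next
    case False
    then have *: "{w \<in> cyl D L I. hit p n w \<and> hit p m w} = {}" by auto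
    show ?thesis unfolding * using C p01(1)[of m] by (simp add: cyl_mass_nonneg)
  qed
  have 2: "(\<Sum>I'\<in>cyl D m I. if good I' then sum q (cyl D L I') else 0)
      \<le> C1 * (p n + \<theta> ^ (m - n)) * sum q (cyl D L I)" if "I \<in> cyl D n u" for I
  proof -
    have I: "I \<in> words D n" using that by (rule cyl_words)
    have lI: "length I = n" using I by (simp add: wordsD)
    let ?s = "stop (p n) I"
    note st = stop[OF I order_refl p01 np]
    let ?t = "take (m - n) ?s"
    have t: "?t \<in> words D (length ?t)" using st(3) by (auto simp: words_def dest: in_set_takeD)
    have lt: "n + length ?t \<le> m" using nm by simp
    have *: "{I' \<in> cyl D m I. good I'} = cyl D m (pre I)"
    proof -
      have "take n I' = I" if "take (length (pre I)) I' = pre I" for I'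
        using arg_cong[OF that, of "take n"] lI by (simp add: pre_def min_def)
      then show ?thesis by (auto simp: cyl_def lI good_def)
    qed
    have "(\<Sum>I'\<in>cyl D m I. if good I' then sum q (cyl D L I') else 0)
        = (\<Sum>I'\<in>cyl D m (pre I). sum q (cyl D L I'))"
      unfolding *[symmetric] by (intro sum.inter_filter[symmetric] finite_cyl finite_D)
    also have "\<dots> = sum q (cyl D L (pre I))"
      using lt by (intro sum_cyl_split[symmetric] finite_D nL) (simp add: pre_def lI)
    also have "\<dots> \<le> C1 * q ?t * sum q (cyl D L I)"
      unfolding pre_def using lt nL by (intro cyl_mass_append(1)[OF I t]) auto
    also have "\<dots> \<le> C1 * (p n + \<theta> ^ (m - n)) * sum q (cyl D L I)"
    proof (intro mult_right_mono mult_left_mono cyl_mass_nonneg C)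
      show "q ?t \<le> p n + \<theta> ^ (m - n)"
      \<comment> \<open>A target that fits into the gap has weight at most \<open>p n\<close>;
        otherwise m - n of its letters are matched, and the decay bounds their weight.\<close>
      proof (cases "length ?s \<le> m - n")
        case True
        then show ?thesis using st(4) theta by (simp add: add_increasing2)
      next
        case False
        then have "q ?t \<le> \<theta> ^ (m - n)" using q_decay[of ?t] wordsD(2)[OF t] by simp
        then show ?thesis using p01(1)[of n] by simp
      qed
    qed
    finally show ?thesis .
  qed
  have "sum q {w \<in> cyl D L u. hit p n w \<and> hit p m w}
      \<le> (\<Sum>I\<in>cyl D m u. if good I then C1 * p m * sum q (cyl D L I) else 0)"
    unfolding sum_cyl_filter_split[OF um nL(2)] by (rule sum_mono[OF 1])
  also have "\<dots> = C1 * p m * (\<Sum>I\<in>cyl D m u. if good I then sum q (cyl D L I) else 0)"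
    unfolding sum_distrib_left[of _ _ "cyl D m u"] by (intro sum.cong) auto
  also have "(\<Sum>I\<in>cyl D m u. if good I then sum q (cyl D L I) else 0)
      = (\<Sum>I\<in>cyl D n u. \<Sum>I'\<in>cyl D m I. if good I' then sum q (cyl D L I') else 0)"
    by (rule sum_cyl_split[OF finite_D u nL(3)])
  also have "C1 * p m * \<dots> \<le> C1 * p m * (\<Sum>I\<in>cyl D n u. C1 * (p n + \<theta> ^ (m - n)) * sum q (cyl D L I))"
    using C p01(1)[of m] by (intro mult_left_mono sum_mono[OF 2]) auto
  also have "\<dots> = C1\<^sup>2 * p m * (p n + \<theta> ^ (m - n)) * sum q (cyl D L u)"
    unfolding sum_cyl_split[OF finite_D u nL(1), of q] sum_distrib_left
    by (simp add: power2_eq_square mult_ac)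
  finally show ?thesis .
qed


text \<open>Both the target and the block compared with it lie in the first 2 * n letters. The event
  therefore means the same at every level from 2 * n on, which lets the level be deepened during the
  iteration.\<close>

lemma hit_take:
  assumes n: "n \<in> admissible p" "2 * n \<le> L" "L \<le> M" and w: "w \<in> words D M"
  shows "hit p n (take L w) \<longleftrightarrow> hit p n w"
proof -
  have np: "\<theta> ^ n \<le> p n" using n by (simp add: admissible_def)
  have L: "take L w \<in> words D L" using w n by (intro words_take)
  have "stop (p n) (take n w) = stop (p n) w"
    by (rule stop(6)[OF w _ p01 np]) (use n in simp)
  moreover have "stop (p n) (take n (take L w)) = stop (p n) (take L w)"
    by (rule stop(6)[OF L _ p01 np]) (use n in simp)
  ultimately have st: "stop (p n) (take L w) = stop (p n) w" using n by (simp add: min_def)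
  have "length (stop (p n) w) \<le> n" by (rule stop(1)[OF w _ p01 np]) (use n in simp)
  then have "take (length (stop (p n) w)) (drop n (take L w)) = take (length (stop (p n) w)) (drop n w)"
    using n by (simp add: drop_take min_def)
  then show ?thesis unfolding hit_def st by simp
qed

text \<open>With A the sum of p over F, the first moment is at least c * A and the second at most C
  * A^2 times the cylinder mass, so the resulting proportion c^2 / C is independent of F, L and u.
  The hypothesis A \<ge> 1 absorbs the terms of the second moment that are linear in A.\<close>

lemma hit_any_mass:
  "\<exists>\<kappa>>0. \<kappa> < 1 \<and> (\<forall>F L u. finite F \<longrightarrow> F \<subseteq> admissible p \<longrightarrow>
     (\<forall>n\<in>F. length u \<le> n \<and> 2 * n \<le> L) \<longrightarrow> 1 \<le> sum p F \<longrightarrow>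
     \<kappa> * sum q (cyl D L u) \<le> sum q {w \<in> cyl D L u. \<exists>n\<in>F. hit p n w})"
proof -
  define G where "G = 1 / (1 - \<theta>)"
  define c where "c = \<eta> / (K * C1)"
  \<comment> \<open>Contributions to the second moment: the diagonal, the product term, and the
    overlaps for the two orders of n and k, each summed by G.\<close>
  define C where "C = C1 + C1\<^sup>2 + 2 * C1\<^sup>2 * G"
  have G: "0 < G" using theta by (simp add: G_def)
  have C1: "0 < C1" using K B by simp
  have c: "0 < c" using eta(1) C1 K by (simp add: c_def)
  have C: "0 < C" using K B G unfolding C_def by (intro add_pos_pos mult_pos_pos zero_less_power) auto
  have main: "c\<^sup>2 / C * sum q (cyl D L u) \<le> sum q {w \<in> cyl D L u. \<exists>n\<in>F. hit p n w}"
    if F: "finite F" "F \<subseteq> admissible p" "\<forall>n\<in>F. length u \<le> n \<and> 2 * n \<le> L" and A: "1 \<le> sum p F"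
    for F L u
  proof -
    define m where "m = sum q (cyl D L u)"
    have m0: "0 \<le> m" unfolding m_def by (rule cyl_mass_nonneg)
    define A where "A = sum p F"
    have A1: "1 \<le> A" using A by (simp add: A_def)
    define J where "J n k = sum q {w \<in> cyl D L u. hit p n w \<and> hit p k w}" for n k
    have lower: "c * A * m \<le> (\<Sum>n\<in>F. sum q {w \<in> cyl D L u. hit p n w})"
    proof -
      have "c * p n * m \<le> sum q {w \<in> cyl D L u. hit p n w}" if "n \<in> F" for n
        using hit_mass(2)[of n L u] that F C1 K unfolding c_def m_def
        by (auto simp: field_simps)
      then have "(\<Sum>n\<in>F. c * p n * m) \<le> (\<Sum>n\<in>F. sum q {w \<in> cyl D L u. hit p n w})"
        by (rule sum_mono)
      then show ?thesis by (simp add: A_def sum_distrib_left sum_distrib_right)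
    qed
    define R where "R n k = of_bool (n < k) * \<theta> ^ (k - n)" for n k :: nat
    have R0: "0 \<le> R n k" for n k using theta by (simp add: R_def)
    have Jlt: "J n k \<le> C1\<^sup>2 * p k * (p n + R n k) * m" if "n \<in> F" "k \<in> F" "n < k" for n k
      using joint_hit_mass[of n k L u] that F unfolding J_def m_def R_def by auto
    have Jsym: "J n k = J k n" for n k unfolding J_def by (simp add: conj_commute)
    have Jeq: "J n n \<le> C1 * p n * m" if "n \<in> F" for n
      using hit_mass(1)[of n L u] that F unfolding J_def m_def by auto
    have J: "J n k \<le> (C1 * (of_bool (n = k) * p n) + C1\<^sup>2 * (p n * p k)
        + C1\<^sup>2 * (p k * R n k) + C1\<^sup>2 * (p n * R k n)) * m" if "n \<in> F" "k \<in> F" for n k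
    proof -
      have nn: "0 \<le> C1\<^sup>2 * (p n * p k)" "0 \<le> C1\<^sup>2 * (p k * R n k)" "0 \<le> C1\<^sup>2 * (p n * R k n)"
        "0 \<le> C1 * p n"
        using p01(1)[of n] p01(1)[of k] R0 C1 by (auto intro!: mult_nonneg_nonneg)
      consider "n = k" | "n < k" | "k < n" by linarith
      then show ?thesis
      proof cases
        case 1
        have "J n k \<le> C1 * p n * m" using Jeq that 1 by simp
        also have "\<dots> \<le> (C1 * (of_bool (n = k) * p n) + C1\<^sup>2 * (p n * p k)
          + C1\<^sup>2 * (p k * R n k) + C1\<^sup>2 * (p n * R k n)) * m"
        proof (rule mult_right_mono[OF _ m0])
          have "C1 * (of_bool (n = k) * p n) = C1 * p n" using 1 by simp
          then show "C1 * p n \<le> C1 * (of_bool (n = k) * p n) + C1\<^sup>2 * (p n * p k)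
            + C1\<^sup>2 * (p k * R n k) + C1\<^sup>2 * (p n * R k n)"
            using nn by linarith
        qed
        finally show ?thesis .
      next
        case 2
        have "J n k \<le> (C1\<^sup>2 * (p n * p k) + C1\<^sup>2 * (p k * R n k)) * m"
          using Jlt[OF that 2] by (simp add: algebra_simps)
        also have "\<dots> \<le> (C1 * (of_bool (n = k) * p n) + C1\<^sup>2 * (p n * p k)
          + C1\<^sup>2 * (p k * R n k) + C1\<^sup>2 * (p n * R k n)) * m"
          by (rule mult_right_mono[OF _ m0]) (use nn 2 in simp)
        finally show ?thesis .
      next
        case 3
        have "J n k \<le> (C1\<^sup>2 * (p n * p k) + C1\<^sup>2 * (p n * R k n)) * m"
          using Jlt[OF that(2,1) 3] Jsym[of n k] by (simp add: algebra_simps)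
        also have "\<dots> \<le> (C1 * (of_bool (n = k) * p n) + C1\<^sup>2 * (p n * p k)
          + C1\<^sup>2 * (p k * R n k) + C1\<^sup>2 * (p n * R k n)) * m"
          by (rule mult_right_mono[OF _ m0]) (use nn 3 in simp)
        finally show ?thesis .
      qed
    qed
    have RA: "(\<Sum>k\<in>F. p k * (\<Sum>n\<in>F. R n k)) \<le> G * A"
    proof -
      have "(\<Sum>k\<in>F. p k * (\<Sum>n\<in>F. R n k)) \<le> (\<Sum>k\<in>F. p k * G)"
        unfolding R_def G_def
        by (intro sum_mono mult_left_mono sum_power_diff_le F less_imp_le p01)
      then show ?thesis by (simp add: A_def sum_distrib_left mult.commute)
    qed
    have upper: "(\<Sum>n\<in>F. \<Sum>k\<in>F. J n k) \<le> C * A\<^sup>2 * m"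
    proof -
      have "(\<Sum>n\<in>F. \<Sum>k\<in>F. J n k) \<le> (\<Sum>n\<in>F. \<Sum>k\<in>F. (C1 * (of_bool (n = k) * p n)
          + C1\<^sup>2 * (p n * p k) + C1\<^sup>2 * (p k * R n k) + C1\<^sup>2 * (p n * R k n)) * m)"
        by (intro sum_mono J)
      also have "\<dots> = (C1 * (\<Sum>n\<in>F. \<Sum>k\<in>F. of_bool (n = k) * p n) + C1\<^sup>2 * (\<Sum>n\<in>F. \<Sum>k\<in>F. p n * p k)
          + C1\<^sup>2 * (\<Sum>n\<in>F. \<Sum>k\<in>F. p k * R n k) + C1\<^sup>2 * (\<Sum>n\<in>F. \<Sum>k\<in>F. p n * R k n)) * m"
        by (simp add: sum.distrib sum_distrib_left sum_distrib_right distrib_right)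
      also have "(\<Sum>n\<in>F. \<Sum>k\<in>F. of_bool (n = k) * p n) = A"
        using F(1) by (simp add: A_def of_bool_def if_distrib[of "\<lambda>x. x * _"] cong: if_cong)
      also have "(\<Sum>n\<in>F. \<Sum>k\<in>F. p n * p k) = A\<^sup>2"
        by (simp add: A_def power2_eq_square sum_product)
      also have "(\<Sum>n\<in>F. \<Sum>k\<in>F. p k * R n k) = (\<Sum>k\<in>F. p k * (\<Sum>n\<in>F. R n k))"
        by (subst sum.swap) (simp add: sum_distrib_left)
      also have "(\<Sum>n\<in>F. \<Sum>k\<in>F. p n * R k n) = (\<Sum>k\<in>F. p k * (\<Sum>n\<in>F. R n k))"
        by (simp add: sum_distrib_left)
      also have "(C1 * A + C1\<^sup>2 * A\<^sup>2 + C1\<^sup>2 * (\<Sum>k\<in>F. p k * (\<Sum>n\<in>F. R n k))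
          + C1\<^sup>2 * (\<Sum>k\<in>F. p k * (\<Sum>n\<in>F. R n k))) * m
          \<le> (C1 * A\<^sup>2 + C1\<^sup>2 * A\<^sup>2 + C1\<^sup>2 * (G * A\<^sup>2) + C1\<^sup>2 * (G * A\<^sup>2)) * m"
      proof -
        have AA: "A \<le> A\<^sup>2" using A1 by (simp add: power2_eq_square)
        then have "G * A \<le> G * A\<^sup>2" using G by (intro mult_left_mono) auto
        then have *: "(\<Sum>k\<in>F. p k * (\<Sum>n\<in>F. R n k)) \<le> G * A\<^sup>2" using RA by simp
        show ?thesis using C1 by (intro mult_right_mono add_mono mult_left_mono AA * m0) auto
      qed
      also have "\<dots> = C * A\<^sup>2 * m" by (simp add: C_def algebra_simps)
      finally show ?thesis .
    qed
    \<comment> \<open>The maximiser of 2 * t * c * A - t^2 * C * A^2, with value c^2 / C.\<close>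
    define t where "t = c / (C * A)"
    have t: "0 < t" using c C A1 by (simp add: t_def)
    have "c\<^sup>2 / C * m = 2 * t * (c * A * m) - t\<^sup>2 * (C * A\<^sup>2 * m)"
      using C A1 by (simp add: t_def power2_eq_square field_simps)
    also have "\<dots> \<le> 2 * t * (\<Sum>n\<in>F. sum q {w \<in> cyl D L u. hit p n w})
        - t\<^sup>2 * (\<Sum>n\<in>F. \<Sum>k\<in>F. J n k)"
      using t by (intro diff_mono mult_left_mono lower upper) auto
    also have "\<dots> \<le> sum q {w \<in> cyl D L u. \<exists>n\<in>F. hit p n w}"
      unfolding J_def
      by (intro second_moment finite_cyl finite_D F) (auto intro: q_nonneg cyl_words)
    finally show ?thesis unfolding m_def .
  qed
  \<comment> \<open>The cap at 1 / 2 guarantees \<kappa> < 1, so that 1 - \<kappa> is a positive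
    factor in the iteration.\<close>
  define \<kappa> where "\<kappa> = min (c\<^sup>2 / C) (1 / 2)"
  have "\<kappa> * sum q (cyl D L u) \<le> c\<^sup>2 / C * sum q (cyl D L u)" for L u
    by (intro mult_right_mono cyl_mass_nonneg) (simp add: \<kappa>_def)
  moreover have "0 < \<kappa>" "\<kappa> < 1" using c C by (auto simp: \<kappa>_def)
  ultimately show ?thesis using main by (meson order_trans)
qed

text \<open>Outside \<open>admissible p\<close> the terms are below \<theta> ^ n, hence summable, so
  the divergence lies on the admissible times. Any tail of them then contains a finite block with
  sum at least 1.\<close>

lemma divergent_admissible:
  assumes "\<not> summable p"
  shows "\<exists>F. finite F \<and> F \<subseteq> admissible p \<and> (\<forall>n\<in>F. N \<le> n) \<and> 1 \<le> sum p F"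
proof (rule ccontr)
  assume neg: "\<not> ?thesis"
  define g where "g n = (if n \<in> admissible p then p n else 0)" for n
  have "summable (\<lambda>n. g (n + N))"
  proof (rule summableI_nonneg_bounded[where x = 1])
    fix n show "0 \<le> g (n + N)" using p01(1)[of "n + N"] by (simp add: g_def)
    define F where "F = (\<lambda>i. i + N) ` {..<n} \<inter> admissible p"
    have "(\<Sum>i<n. g (i + N)) = sum g ((\<lambda>i. i + N) ` {..<n})"
      by (subst sum.reindex) auto
    also have "\<dots> = sum p F"
      unfolding F_def g_def by (subst sum.inter_restrict) auto
    also have "\<dots> \<le> 1"
    proof (rule ccontr)
      assume "\<not> sum p F \<le> 1"
      then have "finite F \<and> F \<subseteq> admissible p \<and> (\<forall>n\<in>F. N \<le> n) \<and> 1 \<le> sum p F"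
        by (auto simp: F_def)
      then show False using neg by blast
    qed
    finally show "(\<Sum>i<n. g (i + N)) \<le> 1" .
  qed
  then have "summable g" by (subst (asm) summable_iff_shift)
  then have "summable (\<lambda>n. g n + \<theta> ^ n)"
    using theta by (intro summable_add) auto
  then have "summable p"
  proof (rule summable_comparison_test')
    fix n show "norm (p n) \<le> g n + \<theta> ^ n"
      using p01(1)[of n] theta by (auto simp: g_def admissible_def)
  qed
  then show False using assms by simp
qed

text \<open>Whether a word has been hit at the times testable at level L is settled by its first L
  letters. A new block F of times beyond L hits a proportion \<kappa> of every cylinder of length L,
  so each round multiplies the unhit mass by at most 1 - \<kappa>.\<close>

lemma never_hit_mass:
  assumes div: "\<not> summable p" and \<epsilon>: "0 < \<epsilon>"
  shows "\<exists>L\<ge>N. sum q {w \<in> words D L. \<forall>n\<in>admissible p. N \<le> n \<and> 2 * n \<le> L \<longrightarrow> \<not> hit p n w} \<le> \<epsilon>"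
proof -
  obtain \<kappa> where \<kappa>: "0 < \<kappa>" "\<kappa> < 1"
    and main: "\<And>F L u. finite F \<Longrightarrow> F \<subseteq> admissible p \<Longrightarrow>
     (\<forall>n\<in>F. length u \<le> n \<and> 2 * n \<le> L) \<Longrightarrow> 1 \<le> sum p F \<Longrightarrow>
     \<kappa> * sum q (cyl D L u) \<le> sum q {w \<in> cyl D L u. \<exists>n\<in>F. hit p n w}"
    using hit_any_mass by blast
  define bad where "bad L w \<longleftrightarrow> (\<forall>n\<in>admissible p. N \<le> n \<and> 2 * n \<le> L \<longrightarrow> \<not> hit p n w)" for L w
  \<comment> \<open>Masses at different levels are only comparable, not equal. Bounding all deeper
    levels M at once prevents a comparison constant from entering in every round.\<close>
  have "\<exists>L\<ge>N. \<forall>M\<ge>L. sum q {w \<in> words D M. bad L w} \<le> (1 - \<kappa>) ^ s * B" for s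
  proof (induction s)
    case 0
    have "sum q {w \<in> words D M. bad N w} \<le> sum q (words D M)" for M
      by (rule sum_mono2) (auto simp: finite_words finite_D intro: q_nonneg)
    then show ?case using mass_upper by (intro exI[of _ N]) (auto intro: order_trans)
  next
    case (Suc s)
    then obtain L where L: "N \<le> L" "\<And>M. L \<le> M \<Longrightarrow> sum q {w \<in> words D M. bad L w} \<le> (1 - \<kappa>) ^ s * B"
      by blast
    obtain F where F: "finite F" "F \<subseteq> admissible p" "\<forall>n\<in>F. L \<le> n" "1 \<le> sum p F"
      using divergent_admissible[OF div, of L] by blast
    \<comment> \<open>Adding 2 * n for every n in F is a crude way to make all these times testable
      at the new level.\<close>
    define L' where "L' = L + 2 * \<Sum>F"
    have FL: "2 * n \<le> L'" if "n \<in> F" for n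
      using member_le_sum[of n F "\<lambda>n. n"] that F(1) by (simp add: L'_def)
    have "sum q {w \<in> words D M. bad L' w} \<le> (1 - \<kappa>) ^ Suc s * B" if M: "L' \<le> M" for M
    proof -
      have LM: "L \<le> M" using M by (simp add: L'_def)
      have split: "sum q {w \<in> words D M. P w} = (\<Sum>u\<in>words D L. sum q {w \<in> cyl D M u. P w})" for P
        using sum_cyl_filter_split[of "[]" L M P] LM by simp
      have cylL: "bad L w \<longleftrightarrow> bad L u" if "w \<in> cyl D M u" "u \<in> words D L" for w u
        using that hit_take[of _ L M w] LM unfolding bad_def by (auto simp: cyl_def wordsD)
      have step: "sum q {w \<in> cyl D M u. bad L' w} \<le> (1 - \<kappa>) * sum q {w \<in> cyl D M u. bad L w}"
        if u: "u \<in> words D L" for u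
      proof (cases "bad L u")
        case True
        then have eq: "{w \<in> cyl D M u. bad L w} = cyl D M u" using cylL[OF _ u] by auto
        define H where "H = {w \<in> cyl D M u. \<exists>n\<in>F. hit p n w}"
        have "{w \<in> cyl D M u. bad L' w} \<subseteq> cyl D M u - H"
          using F(2,3) FL L(1) unfolding bad_def H_def by force
        then have "sum q {w \<in> cyl D M u. bad L' w} \<le> sum q (cyl D M u - H)"
          by (intro sum_mono2) (auto simp: finite_cyl finite_D intro: q_nonneg cyl_words)
        also have "\<dots> = sum q (cyl D M u) - sum q H"
          by (intro sum_diff finite_cyl finite_D) (auto simp: H_def)
        also have "\<dots> \<le> sum q (cyl D M u) - \<kappa> * sum q (cyl D M u)"
          unfolding H_def using F FL M u
          by (intro diff_left_mono main) (auto simp: wordsD intro: order_trans)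
        finally show ?thesis unfolding eq by (simp add: algebra_simps)
      next
        case False
        then have eq: "{w \<in> cyl D M u. bad L w} = {}" using cylL[OF _ u] by auto
        moreover have "bad L w" if "bad L' w" for w using that by (simp add: bad_def L'_def)
        ultimately have "{w \<in> cyl D M u. bad L' w} = {}" by auto
        with eq show ?thesis by (simp only: sum.empty)
      qed
      have "sum q {w \<in> words D M. bad L' w} \<le> (\<Sum>u\<in>words D L. (1 - \<kappa>) * sum q {w \<in> cyl D M u. bad L w})"
        unfolding split by (rule sum_mono[OF step])
      also have "\<dots> = (1 - \<kappa>) * sum q {w \<in> words D M. bad L w}"
        unfolding split by (simp add: sum_distrib_left)
      also have "\<dots> \<le> (1 - \<kappa>) * ((1 - \<kappa>) ^ s * B)"
        using \<kappa> by (intro mult_left_mono L LM) auto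
      finally show ?thesis by simp
    qed
    then show ?case using L(1) by (intro exI[of _ L']) (auto simp: L'_def)
  qed
  note ex = this
  obtain s where s: "(1 - \<kappa>) ^ s < \<epsilon> / B"
    using real_arch_pow_inv[of "\<epsilon> / B" "1 - \<kappa>"] \<kappa> \<epsilon> B by auto
  obtain L where "N \<le> L" "\<And>M. L \<le> M \<Longrightarrow> sum q {w \<in> words D M. bad L w} \<le> (1 - \<kappa>) ^ s * B"
    using ex by blast
  moreover have "(1 - \<kappa>) ^ s * B \<le> \<epsilon>" using s B by (simp add: field_simps)
  ultimately show ?thesis unfolding bad_def by (meson order_refl order_trans)
qed

end
end

section \<open>Hausdorff measure\<close>

lemma hausdorff_content_le:
  assumes "A \<subseteq> (\<Union>k. U k)" "\<And>k. bounded (U k)" "\<And>k. diameter (U k) \<le> \<delta>"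
  shows "hausdorff_content \<delta> s A \<le> (\<Sum>k. diam_power s (U k))"
  unfolding hausdorff_content_def by (rule Inf_lower) (use assms in blast)

lemma hausdorff_content_mono: "A \<subseteq> B \<Longrightarrow> hausdorff_content \<delta> s A \<le> hausdorff_content \<delta> s B"
  unfolding hausdorff_content_def by (rule Inf_superset_mono) blast

lemma hausdorff_content_le_diam_power:
  fixes A :: "'a::metric_space set"
  assumes "bounded A" "diameter A \<le> \<delta>" "0 \<le> \<delta>"
  shows "hausdorff_content \<delta> s A \<le> diam_power s A"
proof -
  define U where "U k = (if k = (0::nat) then A else {})" for k
  have "hausdorff_content \<delta> s A \<le> (\<Sum>k. diam_power s (U k))"
    by (rule hausdorff_content_le) (use assms in \<open>auto simp: U_def split: if_splits\<close>)
  also have "\<dots> = (\<Sum>k\<in>{0}. diam_power s (U k))"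
    by (rule suminf_finite) (auto simp: U_def diam_power_def)
  finally show ?thesis by (simp add: U_def)
qed

lemma hausdorff_content_Union:
  fixes A :: "nat \<Rightarrow> 'a::metric_space set"
  shows "hausdorff_content \<delta> s (\<Union>n. A n) \<le> (\<Sum>n. hausdorff_content \<delta> s (A n))"
proof (rule ennreal_le_epsilon)
  fix e :: real assume fin: "(\<Sum>n. hausdorff_content \<delta> s (A n)) < top" and e: "0 < e"
  define e' where "e' n = e * (1/2) ^ Suc n" for n :: nat
  have e'_pos: "0 < e' n" for n using e by (simp add: e'_def)
  have finn: "hausdorff_content \<delta> s (A n) < top" for n
    using fin ennreal_suminf_lessD by blast
  have "\<exists>U. A n \<subseteq> (\<Union>k. U k) \<and> (\<forall>k. bounded (U k) \<and> diameter (U k) \<le> \<delta>) \<and>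
      (\<Sum>k. diam_power s (U k)) < hausdorff_content \<delta> s (A n) + ennreal (e' n)" for n
  proof -
    have "hausdorff_content \<delta> s (A n) < hausdorff_content \<delta> s (A n) + ennreal (e' n)"
      using finn[of n] e'_pos[of n] by (simp add: ennreal_add_left_cancel_less less_top[symmetric])
    then show ?thesis
      unfolding hausdorff_content_def[of \<delta> s "A n"] Inf_less_iff
      by (auto simp: hausdorff_content_def)
  qed
  then obtain U where U: "\<And>n. A n \<subseteq> (\<Union>k. U n k)"
    "\<And>n k. bounded (U n k)" "\<And>n k. diameter (U n k) \<le> \<delta>"
    "\<And>n. (\<Sum>k. diam_power s (U n k)) < hausdorff_content \<delta> s (A n) + ennreal (e' n)"
    by metis
  define W where "W m = (case prod_decode m of (n, k) \<Rightarrow> U n k)" for m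
  have "hausdorff_content \<delta> s (\<Union>n. A n) \<le> (\<Sum>m. diam_power s (W m))"
  proof (rule hausdorff_content_le)
    show "(\<Union>n. A n) \<subseteq> (\<Union>m. W m)"
    proof
      fix x assume "x \<in> (\<Union>n. A n)"
      then obtain n k where "x \<in> U n k" using U(1) by blast
      then show "x \<in> (\<Union>m. W m)"
        by (intro UN_I[of "prod_encode (n, k)"]) (auto simp: W_def)
    qed
  qed (auto simp: W_def U split: prod.split)
  also have "\<dots> = (\<Sum>n. \<Sum>k. diam_power s (U n k))"
    using suminf_ennreal_2dimen[of "\<lambda>n. \<Sum>k. diam_power s (U n k)" "\<lambda>(n, k). diam_power s (U n k)"]
    by (simp add: W_def comp_def split_beta)
  also have "\<dots> \<le> (\<Sum>n. hausdorff_content \<delta> s (A n) + ennreal (e' n))"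
    by (intro suminf_le allI less_imp_le U) auto
  also have "\<dots> = (\<Sum>n. hausdorff_content \<delta> s (A n)) + (\<Sum>n. ennreal (e' n))"
    by (rule suminf_add[symmetric]) auto
  also have "(\<Sum>n. ennreal (e' n)) = ennreal e"
  proof (rule suminf_ennreal_eq)
    show "e' sums e" using sums_mult[OF power_half_series, of e] by (simp add: e'_def[abs_def])
  qed (use e'_pos less_imp_le in auto)
  finally show "hausdorff_content \<delta> s (\<Union>n. A n) \<le> (\<Sum>n. hausdorff_content \<delta> s (A n)) + ennreal e" .
qed

lemma hausdorff_content_empty: "0 \<le> \<delta> \<Longrightarrow> hausdorff_content \<delta> s {} = 0"
  using hausdorff_content_le_diam_power[of "{}" \<delta> s] by (simp add: diam_power_def)

lemma hausdorff_content_UN_finite: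
  fixes A :: "'b \<Rightarrow> 'a::metric_space set"
  assumes "finite I" "0 \<le> \<delta>"
  shows "hausdorff_content \<delta> s (\<Union>i\<in>I. A i) \<le> (\<Sum>i\<in>I. hausdorff_content \<delta> s (A i))"
  using assms(1)
proof induction
  case (insert j I)
  define C where "C n = (if n = 0 then A j else if n = Suc 0 then (\<Union>i\<in>I. A i) else {})" for n
  have "(\<Union>n. C n) = (\<Union>i\<in>insert j I. A i)"
    unfolding C_def by (auto split: if_splits)
  then have "hausdorff_content \<delta> s (\<Union>i\<in>insert j I. A i) \<le> (\<Sum>n. hausdorff_content \<delta> s (C n))"
    using hausdorff_content_Union[of \<delta> s C] by simp
  also have "\<dots> = (\<Sum>n\<in>{0,Suc 0}. hausdorff_content \<delta> s (C n))"
    by (rule suminf_finite) (auto simp: C_def hausdorff_content_empty[OF assms(2)])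
  also have "\<dots> = hausdorff_content \<delta> s (A j) + hausdorff_content \<delta> s (\<Union>i\<in>I. A i)"
    by (simp add: C_def)
  finally show ?case using insert by (simp add: add_left_mono order_trans)
qed (simp add: hausdorff_content_empty assms)

lemma hausdorff_measure_mono: "A \<subseteq> B \<Longrightarrow> hausdorff_measure s A \<le> hausdorff_measure s B"
  unfolding hausdorff_measure_def by (intro SUP_mono') (rule hausdorff_content_mono)

lemma hausdorff_measure_Union:
  fixes A :: "nat \<Rightarrow> 'a::metric_space set"
  shows "hausdorff_measure s (\<Union>n. A n) \<le> (\<Sum>n. hausdorff_measure s (A n))"
  unfolding hausdorff_measure_def[of s "\<Union>n. A n"]
proof (rule SUP_least)
  fix \<delta> :: real assume "\<delta> \<in> {0<..}"
  then have "hausdorff_content \<delta> s (A n) \<le> hausdorff_measure s (A n)" for n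
    unfolding hausdorff_measure_def by (rule SUP_upper)
  then have "(\<Sum>n. hausdorff_content \<delta> s (A n)) \<le> (\<Sum>n. hausdorff_measure s (A n))"
    by (intro suminf_le) auto
  then show "hausdorff_content \<delta> s (\<Union>n. A n) \<le> (\<Sum>n. hausdorff_measure s (A n))"
    using hausdorff_content_Union[of \<delta> s A] by (rule order_trans[rotated])
qed

lemma hausdorff_measure_Un:
  fixes A B :: "'a::metric_space set"
  shows "hausdorff_measure s (A \<union> B) \<le> hausdorff_measure s A + hausdorff_measure s B"
  unfolding hausdorff_measure_def[of s "A \<union> B"]
proof (rule SUP_least)
  fix \<delta> :: real assume d: "\<delta> \<in> {0<..}"
  have "hausdorff_content \<delta> s (A \<union> B) \<le> (\<Sum>b\<in>UNIV. hausdorff_content \<delta> s (if b then A else B))"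
    using hausdorff_content_UN_finite[of UNIV \<delta> s "\<lambda>b. if b then A else B"] d by (simp add: UNIV_bool Un_commute)
  also have "\<dots> = hausdorff_content \<delta> s A + hausdorff_content \<delta> s B"
    by (simp add: UNIV_bool add.commute)
  also have "\<dots> \<le> hausdorff_measure s A + hausdorff_measure s B"
    unfolding hausdorff_measure_def using d by (intro add_mono SUP_upper) auto
  finally show "hausdorff_content \<delta> s (A \<union> B) \<le> hausdorff_measure s A + hausdorff_measure s B" .
qed

lemma hausdorff_measure_zeroI:
  fixes A :: "'a::metric_space set"
  assumes "\<And>\<delta> \<epsilon>. 0 < \<delta> \<Longrightarrow> 0 < \<epsilon> \<Longrightarrow> hausdorff_content \<delta> s A \<le> ennreal \<epsilon>"
  shows "hausdorff_measure s A = 0"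
proof -
  have "hausdorff_content \<delta> s A = 0" if "0 < \<delta>" for \<delta>
  proof -
    have "hausdorff_content \<delta> s A \<le> 0"
      by (rule ennreal_le_epsilon) (use assms that in auto)
    then show ?thesis by simp
  qed
  then show ?thesis unfolding hausdorff_measure_def by (simp add: SUP_eq_const)
qed

text \<open>With s > 0 the convention for exponent 0 does not intervene, and \<open>powr\<close> is
  monotone in the diameter down to diameter 0.\<close>

lemma hausdorff_content_le_powr:
  fixes A :: "'a::metric_space set"
  assumes dist: "\<And>x y. x \<in> A \<Longrightarrow> y \<in> A \<Longrightarrow> dist x y \<le> r" and r: "0 \<le> r" "r \<le> \<delta>" and s: "0 < s"
  shows "hausdorff_content \<delta> s A \<le> ennreal (r powr s)"
proof -
  have "bounded A" unfolding bounded_two_points using dist by blast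
  moreover have d: "diameter A \<le> r" 
    unfolding diameter_def using dist r by (auto intro!: cSUP_least)
  ultimately have "hausdorff_content \<delta> s A \<le> diam_power s A"
    using r by (intro hausdorff_content_le_diam_power) auto
  also have "\<dots> \<le> ennreal (r powr s)"
    unfolding diam_power_def using s d diameter_ge_0[OF \<open>bounded A\<close>] by (auto intro!: ennreal_leI powr_mono2)
  finally show ?thesis .
qed

section \<open>Distortion and pressure\<close>

text \<open>Fekete's lemma: writing n = k * n0 + s bounds u n by k * u n0 plus a constant, so the
  quotients approach their infimum. The linear lower bound makes this infimum finite.\<close>

lemma subadditive_convergent:
  fixes u :: "nat \<Rightarrow> real"
  assumes u0: "u 0 = 0" and sub: "\<And>m n. u (m + n) \<le> u m + u n" and low: "\<And>n. - C * real n \<le> u n"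
  shows "convergent (\<lambda>n. u n / real n)"
proof -
  define L where "L = (INF n\<in>{1..}. u n / real n)"
  have bdd: "bdd_below ((\<lambda>n. u n / real n) ` {1..})"
    using low by (intro bdd_belowI[of _ "- C"]) (auto simp: field_simps)
  have L: "L \<le> u n / real n" if "1 \<le> n" for n
    unfolding L_def using bdd that by (intro cINF_lower) auto
  have mult: "u (k * n) \<le> real k * u n" for k n
  proof (induction k)
    case (Suc k)
    then show ?case using sub[of n "k * n"] by (simp add: distrib_right)
  qed (simp add: u0)
  have "(\<lambda>n. u n / real n) \<longlonglongrightarrow> L"
  proof (rule LIMSEQ_I)
    fix e :: real assume e: "0 < e"
    have "\<exists>n\<in>{1..}. u n / real n < L + e / 2"
      using e cINF_less_iff[OF _ bdd, of "L + e / 2"] by (simp add: L_def)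
    then obtain n0 where n0: "1 \<le> n0" "u n0 / real n0 < L + e / 2" by auto
    define v where "v = u n0 / real n0"
    define M where "M = (\<Sum>s<n0. \<bar>u s\<bar>)"
    have M: "u s \<le> M" if "s < n0" for s
      using member_le_sum[of s "{..<n0}" "\<lambda>s. \<bar>u s\<bar>"] that by (auto simp: M_def)
    have up: "u n / real n \<le> v + (real n0 * \<bar>v\<bar> + M) / real n" if n: "1 \<le> n" for n
    proof -
      define k s where "k = n div n0" and "s = n mod n0"
      have s: "s < n0" and ks: "n = k * n0 + s" using n0 by (auto simp: k_def s_def)
      have "u n \<le> real k * u n0 + M" using sub[of "k * n0" s] mult[of k n0] M[OF s] ks by simp
      also have "real k * u n0 = (real n - real s) * v" using n0 by (simp add: v_def ks)
      also have "(real n - real s) * v \<le> real n * v + real n0 * \<bar>v\<bar>"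
      proof -
        have "- real s * v \<le> real s * \<bar>v\<bar>" using mult_left_mono[of "- v" "\<bar>v\<bar>" "real s"] by simp
        also have "\<dots> \<le> real n0 * \<bar>v\<bar>" using s by (intro mult_right_mono) auto
        finally show ?thesis by (simp add: algebra_simps)
      qed
      finally show ?thesis using n by (simp add: field_simps)
    qed
    have "(\<lambda>n. (real n0 * \<bar>v\<bar> + M) / real n) \<longlonglongrightarrow> 0"
      by (intro tendsto_divide_0[OF tendsto_const] filterlim_at_top_imp_at_infinity filterlim_real_sequentially)
    then have "\<forall>\<^sub>F n in sequentially. (real n0 * \<bar>v\<bar> + M) / real n < e / 2"
      using e by (intro order_tendstoD) auto
    then obtain N where N: "\<And>n. N \<le> n \<Longrightarrow> (real n0 * \<bar>v\<bar> + M) / real n < e / 2"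
      unfolding eventually_sequentially by blast
    show "\<exists>no. \<forall>n\<ge>no. norm (u n / real n - L) < e"
    proof (intro exI[of _ "max 1 N"] allI impI)
      fix n assume "max 1 N \<le> n"
      then have "1 \<le> n" "N \<le> n" by auto
      then show "norm (u n / real n - L) < e"
        using L[of n] up[of n] N[of n] n0(2)[folded v_def] unfolding real_norm_def by linarith
    qed
  qed
  then show ?thesis by (rule convergentI)
qed

section \<open>Word maps and their derivatives\<close>

lemma power_powr: "0 < x \<Longrightarrow> (x ^ n) powr s = (x powr s) ^ n" for x s :: real
  by (simp add: powr_powr powr_realpow[symmetric] mult.commute)

lemma word_map_Nil [simp]: "word_map \<phi> [] = id"
  and word_map_Cons [simp]: "word_map \<phi> (i # I) = \<phi> i \<circ> word_map \<phi> I"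
  by (simp_all add: word_map_def)

lemma word_map_append: "word_map \<phi> (I @ J) = word_map \<phi> I \<circ> word_map \<phi> J"
  by (induction I) auto

text \<open>The chain-rule product of the derivative norms along the orbit of x. By conformality it
  is the derivative norm of the composition on V, as \<open>deriv_norm_word_map\<close>
  shows.\<close>

primrec word_deriv :: "('i \<Rightarrow> 'a::euclidean_space \<Rightarrow> 'a) \<Rightarrow> 'i list \<Rightarrow> 'a \<Rightarrow> real" where
  "word_deriv \<phi> [] x = 1"
| "word_deriv \<phi> (i # I) x = deriv_norm (\<phi> i) (word_map \<phi> I x) * word_deriv \<phi> I x"

lemma word_deriv_append:
  "word_deriv \<phi> (I @ J) x = word_deriv \<phi> I (word_map \<phi> J x) * word_deriv \<phi> J x"
  by (induction I) (auto simp: word_map_append)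

lemma onorm_conformal:
  fixes F :: "'a::euclidean_space \<Rightarrow> 'a"
  assumes "\<And>v. norm (F v) = c * norm v"
  shows "onorm F = c"
proof -
  obtain b :: 'a where b: "b \<in> Basis" using nonempty_Basis by blast
  have "norm (F x) / norm x = (if x = 0 then 0 else c)" for x using assms by simp
  moreover have "0 \<le> c" using assms[of b] b norm_ge_zero[of "F b"] by simp
  moreover have "range (\<lambda>x::'a. if x = 0 then 0 else c) = {0, c}"
    using b nonzero_Basis[OF b] by (auto simp: image_iff)
  ultimately show ?thesis unfolding onorm_def by (simp add: cSup_insert sup_max)
qed

text \<open>The infima, suprema and contraction ratios of the finitely many maps are replaced by
  single constants lo, \<rho> and r, with r a contraction ratio on all of V. Their existence is
  shown in \<open>conformal_ifs_imp_cifs\<close>.\<close>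

locale cifs =
  fixes D :: "'i set" and \<phi> :: "'i \<Rightarrow> 'a::euclidean_space \<Rightarrow> 'a" and Y V X :: "'a set"
    and r \<rho> lo \<alpha> c :: real
  assumes finite_D: "finite D" and compact_Y: "compact Y" and Y_V: "Y \<subseteq> V"
    and maps_Y: "\<And>i x. i \<in> D \<Longrightarrow> x \<in> Y \<Longrightarrow> \<phi> i x \<in> Y" and open_V: "open V"
    and maps_V: "\<And>i x. i \<in> D \<Longrightarrow> x \<in> V \<Longrightarrow> \<phi> i x \<in> V"
    and r: "0 < r" "r < 1"
    and lipschitz: "\<And>i x y. i \<in> D \<Longrightarrow> x \<in> V \<Longrightarrow> y \<in> V \<Longrightarrow> norm (\<phi> i x - \<phi> i y) \<le> r * norm (x - y)"
    and deriv: "\<And>i x. i \<in> D \<Longrightarrow> x \<in> V \<Longrightarrow> \<exists>F. (\<phi> i has_derivative F) (at x) \<and>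
        (\<forall>v. norm (F v) = deriv_norm (\<phi> i) x * norm v)"
    and lo: "0 < lo" "\<And>i x. i \<in> D \<Longrightarrow> x \<in> V \<Longrightarrow> lo \<le> deriv_norm (\<phi> i) x"
    and rho: "\<rho> < 1" "\<And>i x. i \<in> D \<Longrightarrow> x \<in> V \<Longrightarrow> deriv_norm (\<phi> i) x \<le> \<rho>"
    and holder: "0 < \<alpha>" "0 < c" "\<And>i x y. i \<in> D \<Longrightarrow> x \<in> V \<Longrightarrow> y \<in> V \<Longrightarrow>
        \<bar>deriv_norm (\<phi> i) x - deriv_norm (\<phi> i) y\<bar> \<le> c * norm (x - y) powr \<alpha>"
    and X_ne: "X \<noteq> {}" and compact_X: "compact X" and X_Y: "X \<subseteq> Y"
    and X_eq: "X = (\<Union>i\<in>D. \<phi> i ` X)"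
begin

lemma X_V: "X \<subseteq> V" using X_Y Y_V by blast

lemma D_ne: "D \<noteq> {}" using X_ne X_eq by auto

lemma rho_pos: "0 < \<rho>"
proof -
  obtain i x where "i \<in> D" "x \<in> V" using D_ne X_ne X_V by blast
  then show ?thesis using lo(1) lo(2)[of i x] rho(2)[of i x] by linarith
qed

lemma word_map_V: "set I \<subseteq> D \<Longrightarrow> x \<in> V \<Longrightarrow> word_map \<phi> I x \<in> V"
  by (induction I) (auto intro: maps_V)

lemma word_map_Y: "set I \<subseteq> D \<Longrightarrow> x \<in> Y \<Longrightarrow> word_map \<phi> I x \<in> Y"
  by (induction I) (auto intro: maps_Y)

lemma maps_X: "i \<in> D \<Longrightarrow> x \<in> X \<Longrightarrow> \<phi> i x \<in> X"
  using X_eq by blast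

lemma word_map_X: "set I \<subseteq> D \<Longrightarrow> x \<in> X \<Longrightarrow> word_map \<phi> I x \<in> X"
  by (induction I) (auto intro: maps_X)

lemma X_words: "X = (\<Union>I\<in>words D n. word_map \<phi> I ` X)"
proof (induction n)
  case (Suc n)
  show ?case
  proof
    show "X \<subseteq> (\<Union>I\<in>words D (Suc n). word_map \<phi> I ` X)"
    proof
      fix x assume "x \<in> X"
      then obtain i y where i: "i \<in> D" "y \<in> X" "x = \<phi> i y" using X_eq by blast
      then obtain I z where "I \<in> words D n" "z \<in> X" "y = word_map \<phi> I z" using Suc by blast
      then have "i # I \<in> words D (Suc n)" "x = word_map \<phi> (i # I) z" using i by (auto simp: words_def)
      then show "x \<in> (\<Union>I\<in>words D (Suc n). word_map \<phi> I ` X)" using \<open>z \<in> X\<close> by blast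
    qed
  qed (auto intro: word_map_X simp: words_def)
qed simp

lemma word_map_lipschitz:
  assumes "set I \<subseteq> D" "x \<in> V" "y \<in> V"
  shows "norm (word_map \<phi> I x - word_map \<phi> I y) \<le> r ^ length I * norm (x - y)"
  using assms(1)
proof (induction I)
  case (Cons i I)
  then have "norm (\<phi> i (word_map \<phi> I x) - \<phi> i (word_map \<phi> I y)) \<le> r * norm (word_map \<phi> I x - word_map \<phi> I y)"
    using assms by (intro lipschitz word_map_V) auto
  also have "\<dots> \<le> r * (r ^ length I * norm (x - y))" using Cons r by (intro mult_left_mono) auto
  finally show ?case by (simp add: mult_ac)
qed simp

lemma has_derivative_word_map:
  assumes "set I \<subseteq> D" "x \<in> V"
  shows "\<exists>F. (word_map \<phi> I has_derivative F) (at x) \<and> (\<forall>v. norm (F v) = word_deriv \<phi> I x * norm v)"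
  using assms(1)
proof (induction I)
  case Nil
  show ?case by (intro exI[of _ id]) (auto simp: id_def)
next
  case (Cons i I)
  then obtain F where F: "(word_map \<phi> I has_derivative F) (at x)"
    "\<And>v. norm (F v) = word_deriv \<phi> I x * norm v" by auto
  obtain G where G: "(\<phi> i has_derivative G) (at (word_map \<phi> I x))"
    "\<And>v. norm (G v) = deriv_norm (\<phi> i) (word_map \<phi> I x) * norm v"
    using deriv[of i "word_map \<phi> I x"] Cons assms by (auto intro: word_map_V)
  have "(\<phi> i \<circ> word_map \<phi> I has_derivative G \<circ> F) (at x)"
    by (rule diff_chain_at[OF F(1) G(1)])
  moreover have "norm ((G \<circ> F) v) = word_deriv \<phi> (i # I) x * norm v" for v using F(2) G(2) by simp
  ultimately show ?case by (metis word_map_Cons)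
qed

lemma deriv_norm_word_map:
  assumes "set I \<subseteq> D" "x \<in> V"
  shows "deriv_norm (word_map \<phi> I) x = word_deriv \<phi> I x"
proof -
  obtain F where F: "(word_map \<phi> I has_derivative F) (at x)"
    "\<And>v. norm (F v) = word_deriv \<phi> I x * norm v"
    using has_derivative_word_map[OF assms] by blast
  show ?thesis unfolding deriv_norm_def using frechet_derivative_at[OF F(1)] onorm_conformal[OF F(2)] by simp
qed

section \<open>Bounded distortion and Lipschitz bounds for words\<close>

lemma word_deriv_bounds:
  assumes "set I \<subseteq> D" "x \<in> V"
  shows "lo ^ length I \<le> word_deriv \<phi> I x" "word_deriv \<phi> I x \<le> \<rho> ^ length I" "0 < word_deriv \<phi> I x"
proof -
  have "lo ^ length I \<le> word_deriv \<phi> I x \<and> word_deriv \<phi> I x \<le> \<rho> ^ length I \<and> 0 < word_deriv \<phi> I x"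
    using assms(1)
  proof (induction I)
    case (Cons i I)
    have V: "word_map \<phi> I x \<in> V" using Cons assms by (auto intro: word_map_V)
    have i: "i \<in> D" using Cons by simp
    note b = lo(2)[OF i V] rho(2)[OF i V]
    show ?case using Cons b lo(1) rho_pos by (auto intro!: mult_mono mult_pos_pos)
  qed simp
  then show "lo ^ length I \<le> word_deriv \<phi> I x" "word_deriv \<phi> I x \<le> \<rho> ^ length I" "0 < word_deriv \<phi> I x"
    by auto
qed

text \<open>Adding a letter multiplies the ratio of the derivatives by at most 1 + (c / lo) * t
  \<le> exp ((c / lo) * t), where t bounds the \<alpha>-th power of the distance after the letters
  already applied. Metric contraction on V makes these distances decay, so no path between x and y
  has to stay inside V.\<close>

lemma word_deriv_distortion:
  assumes I: "set I \<subseteq> D" and x: "x \<in> V" and y: "y \<in> V"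
  shows "word_deriv \<phi> I x \<le> exp (c / lo * (\<Sum>k<length I. (r ^ k * norm (x - y)) powr \<alpha>)) * word_deriv \<phi> I y"
  using I
proof (induction I)
  case (Cons i I)
  define u v where "u = word_map \<phi> I x" and "v = word_map \<phi> I y"
  have V: "u \<in> V" "v \<in> V" using Cons x y by (auto simp: u_def v_def intro: word_map_V)
  have i: "i \<in> D" using Cons by simp
  let ?t = "(r ^ length I * norm (x - y)) powr \<alpha>"
  have "norm (u - v) powr \<alpha> \<le> ?t"
    unfolding u_def v_def using Cons x y holder by (intro powr_mono2 word_map_lipschitz) auto
  then have "c * norm (u - v) powr \<alpha> \<le> c * ?t" using holder(2) by (intro mult_left_mono) auto
  then have "deriv_norm (\<phi> i) u \<le> deriv_norm (\<phi> i) v + c * ?t"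
    using holder(3)[OF i V] by linarith
  also have "c * ?t \<le> deriv_norm (\<phi> i) v * (c / lo * ?t)"
  proof -
    have "1 * (c * ?t) \<le> deriv_norm (\<phi> i) v / lo * (c * ?t)"
      using lo(1) lo(2)[OF i V(2)] holder(2) by (intro mult_right_mono) auto
    then show ?thesis by simp
  qed
  then have "deriv_norm (\<phi> i) v + c * ?t \<le> deriv_norm (\<phi> i) v * (1 + c / lo * ?t)"
    by (simp add: distrib_left)
  also have "\<dots> \<le> deriv_norm (\<phi> i) v * exp (c / lo * ?t)"
    using lo(1) lo(2)[OF i V(2)] by (intro mult_left_mono exp_ge_add_one_self) auto
  finally have "deriv_norm (\<phi> i) u * word_deriv \<phi> I x
      \<le> (deriv_norm (\<phi> i) v * exp (c / lo * ?t)) * (exp (c / lo * (\<Sum>k<length I. (r ^ k * norm (x - y)) powr \<alpha>)) * word_deriv \<phi> I y)"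
    using Cons word_deriv_bounds(3)[of I x] x lo(1) lo(2)[OF i V(2)] by (intro mult_mono) auto
  then show ?case by (simp add: u_def v_def distrib_left exp_add mult_ac)
qed simp

text \<open>The exponents in \<open>word_deriv_distortion\<close> are dominated by a geometric
  series of ratio r powr \<alpha>. The constant depends on b because V may be unbounded.\<close>

lemma bounded_distortion:
  assumes I: "set I \<subseteq> D" and x: "x \<in> V" and y: "y \<in> V" and b: "norm (x - y) \<le> b"
  shows "word_deriv \<phi> I x \<le> exp (c / lo * (b powr \<alpha> / (1 - r powr \<alpha>))) * word_deriv \<phi> I y"
proof -
  have ra: "0 < r powr \<alpha>" "r powr \<alpha> < 1" using r holder(1) powr_less_mono2[of \<alpha> r 1] by auto
  have b0: "0 \<le> b" using b norm_ge_zero[of "x - y"] by linarith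
  have "(\<Sum>k<length I. (r ^ k * norm (x - y)) powr \<alpha>) \<le> (\<Sum>k<length I. b powr \<alpha> * (r powr \<alpha>) ^ k)"
  proof (rule sum_mono)
    fix k
    have "(r ^ k * norm (x - y)) powr \<alpha> = (r ^ k) powr \<alpha> * norm (x - y) powr \<alpha>"
      using r by (simp add: powr_mult)
    also have "(r ^ k) powr \<alpha> = (r powr \<alpha>) ^ k"
      using r by (simp add: powr_powr powr_realpow[symmetric] mult.commute)
    also have "(r powr \<alpha>) ^ k * norm (x - y) powr \<alpha> \<le> (r powr \<alpha>) ^ k * b powr \<alpha>"
      using b ra holder(1) by (intro mult_left_mono powr_mono2) auto
    finally show "(r ^ k * norm (x - y)) powr \<alpha> \<le> b powr \<alpha> * (r powr \<alpha>) ^ k" by (simp add: mult.commute)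
  qed
  also have "\<dots> = b powr \<alpha> * (\<Sum>k<length I. (r powr \<alpha>) ^ k)" by (simp add: sum_distrib_left)
  also have "\<dots> \<le> b powr \<alpha> * (1 / (1 - r powr \<alpha>))"
  proof (rule mult_left_mono)
    have "(\<Sum>k<length I. (r powr \<alpha>) ^ k) \<le> (\<Sum>k. (r powr \<alpha>) ^ k)"
      using ra by (intro sum_le_suminf) auto
    then show "(\<Sum>k<length I. (r powr \<alpha>) ^ k) \<le> 1 / (1 - r powr \<alpha>)"
      using ra by (simp add: suminf_geometric)
  qed simp
  finally have "c / lo * (\<Sum>k<length I. (r ^ k * norm (x - y)) powr \<alpha>) \<le> c / lo * (b powr \<alpha> / (1 - r powr \<alpha>))"
    using lo(1) holder(2) by (intro mult_left_mono) auto
  then show ?thesis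
    using word_deriv_distortion[OF I x y] word_deriv_bounds(3)[OF I y]
    by (meson exp_le_cancel_iff less_imp_le mult_right_mono order_trans)
qed

text \<open>The mean value inequality will be applied on balls around points of X, so distortion
  must be controlled there too. Compactness gives a common radius, and a point of such a ball is
  within diameter X + \<epsilon> of every point of X.\<close>

lemma distortion_near_X:
  obtains K \<epsilon> where "1 \<le> K" "0 < \<epsilon>" "\<And>x. x \<in> X \<Longrightarrow> ball x \<epsilon> \<subseteq> V"
    "\<And>I x y z. set I \<subseteq> D \<Longrightarrow> x \<in> X \<Longrightarrow> y \<in> X \<Longrightarrow> z \<in> ball y \<epsilon> \<Longrightarrow> word_deriv \<phi> I z \<le> K * word_deriv \<phi> I x"
proof -
  obtain \<epsilon> where \<epsilon>: "0 < \<epsilon>" "(\<Union>x\<in>X. ball x \<epsilon>) \<subseteq> V"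
    using compact_subset_open_imp_ball_epsilon_subset[OF compact_X open_V X_V] by blast
  define b where "b = diameter X + \<epsilon>"
  define K where "K = exp (c / lo * (b powr \<alpha> / (1 - r powr \<alpha>)))"
  have "r powr \<alpha> < 1" using r holder(1) powr_less_mono2[of \<alpha> r 1] by auto
  then have K: "1 \<le> K" unfolding K_def using lo(1) holder(2) by simp
  have "word_deriv \<phi> I z \<le> K * word_deriv \<phi> I x" if "set I \<subseteq> D" "x \<in> X" "y \<in> X" "z \<in> ball y \<epsilon>" for I x y z
    unfolding K_def
  proof (rule bounded_distortion)
    have "dist y x \<le> diameter X" using that by (intro diameter_bounded_bound compact_imp_bounded compact_X)
    then show "norm (z - x) \<le> b" using that(4) dist_triangle[of z x y]
      by (simp add: b_def dist_norm norm_minus_commute)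
    show "z \<in> V" using that(3,4) \<epsilon>(2) by blast
  qed (use that X_V in auto)
  then show thesis using that[of K \<epsilon>] K \<epsilon> by blast
qed

definition distortion_const :: "real \<Rightarrow> bool" where
  "distortion_const K \<longleftrightarrow> 1 \<le> K \<and>
     (\<forall>I x y. set I \<subseteq> D \<longrightarrow> x \<in> X \<longrightarrow> y \<in> X \<longrightarrow> word_deriv \<phi> I x \<le> K * word_deriv \<phi> I y)"

lemma distortion_constD:
  assumes "distortion_const K"
  shows "1 \<le> K" "\<And>I x y. set I \<subseteq> D \<Longrightarrow> x \<in> X \<Longrightarrow> y \<in> X \<Longrightarrow> word_deriv \<phi> I x \<le> K * word_deriv \<phi> I y"
  using assms by (auto simp: distortion_const_def)

lemma ex_distortion_const: "\<exists>K. distortion_const K"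
proof -
  obtain K \<epsilon> where K: "1 \<le> K" "0 < \<epsilon>" "\<And>I x y z. set I \<subseteq> D \<Longrightarrow> x \<in> X \<Longrightarrow> y \<in> X \<Longrightarrow> z \<in> ball y \<epsilon> \<Longrightarrow>
      word_deriv \<phi> I z \<le> K * word_deriv \<phi> I x"
    by (rule distortion_near_X) (rule that)
  have "distortion_const K" unfolding distortion_const_def using K by auto
  then show ?thesis ..
qed

text \<open>A ball is convex, so the mean value inequality applies on it whatever the shape of
  V.\<close>

lemma word_map_local_lipschitz:
  assumes I: "set I \<subseteq> D" and z: "z \<in> X" and w: "w \<in> ball z \<epsilon>" and V: "ball z \<epsilon> \<subseteq> V"
    and M: "\<And>u. u \<in> ball z \<epsilon> \<Longrightarrow> word_deriv \<phi> I u \<le> M"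
  shows "norm (word_map \<phi> I z - word_map \<phi> I w) \<le> M * norm (z - w)"
proof -
  have "\<forall>u\<in>V. \<exists>F. (word_map \<phi> I has_derivative F) (at u) \<and> (\<forall>v. norm (F v) = word_deriv \<phi> I u * norm v)"
    using has_derivative_word_map[OF I] by blast
  then obtain F where F: "\<And>u. u \<in> V \<Longrightarrow> (word_map \<phi> I has_derivative F u) (at u)"
    "\<And>u v. u \<in> V \<Longrightarrow> norm (F u v) = word_deriv \<phi> I u * norm v" by metis
  show ?thesis
  proof (rule differentiable_bound[where S = "ball z \<epsilon>" and f' = F])
    fix u assume u: "u \<in> ball z \<epsilon>"
    then show "(word_map \<phi> I has_derivative F u) (at u within ball z \<epsilon>)"
      using V by (blast intro: has_derivative_at_withinI[OF F(1)])
    show "onorm (F u) \<le> M"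
      using onorm_conformal[of "F u" "word_deriv \<phi> I u"] F(2)[of u] M[OF u] V u by auto
  next
    show "z \<in> ball z \<epsilon>" using w le_less_trans[OF zero_le_dist, of z w \<epsilon>] by simp
  qed (use w in auto)
qed

text \<open>\<open>V\<close> need not be convex, and two points of \<open>X\<close> need not be joined by a segment in \<open>V\<close>; but
  after applying the last few letters of the word they are close enough.\<close>

lemma word_map_bound_X:
  assumes x0: "x0 \<in> X"
  obtains C where "0 < C"
    "\<And>I z w. set I \<subseteq> D \<Longrightarrow> z \<in> X \<Longrightarrow> w \<in> X \<Longrightarrow> norm (word_map \<phi> I z - word_map \<phi> I w) \<le> C * word_deriv \<phi> I x0 * norm (z - w)"
proof -
  obtain K \<epsilon> where K: "1 \<le> K" and \<epsilon>: "0 < \<epsilon>" "\<And>x. x \<in> X \<Longrightarrow> ball x \<epsilon> \<subseteq> V"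
    and dist: "\<And>I x y z. set I \<subseteq> D \<Longrightarrow> x \<in> X \<Longrightarrow> y \<in> X \<Longrightarrow> z \<in> ball y \<epsilon> \<Longrightarrow> word_deriv \<phi> I z \<le> K * word_deriv \<phi> I x"
    by (rule distortion_near_X) (rule that)
  define d where "d = diameter X"
  have d: "norm (z - w) \<le> d" if "z \<in> X" "w \<in> X" for z w
    unfolding d_def using that diameter_bounded_bound[OF compact_imp_bounded[OF compact_X]] by (simp add: dist_norm)
  have d0: "0 \<le> d" unfolding d_def by (intro diameter_ge_0 compact_imp_bounded compact_X)
  \<comment> \<open>After the last l letters the image of X has diameter below \<epsilon>, so
    \<open>near\<close> applies to the rest of the word.\<close>
  obtain l where l: "r ^ l < \<epsilon> / (d + 1)" using real_arch_pow_inv[of "\<epsilon> / (d + 1)" r] r \<epsilon> d0 by auto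
  have rl: "r ^ l * d < \<epsilon>" 
  proof -
    have "r ^ l * d \<le> r ^ l * (d + 1)" using r by (intro mult_left_mono) auto
    also have "\<dots> < \<epsilon>" using l d0 by (simp add: field_simps)
    finally show ?thesis .
  qed
  \<comment> \<open>One K comes from \<open>near\<close>, the other from moving the base point in
    \<open>wd\<close>; lo ^ l bounds from below the derivative of the split-off l letters. Words
    shorter than l obey the bound because their derivative is at least lo ^ l.\<close>
  define C where "C = K\<^sup>2 / lo ^ l"
  have C0: "0 < C" using K lo(1) by (simp add: C_def)
  have near: "norm (word_map \<phi> I z - word_map \<phi> I w) \<le> K * word_deriv \<phi> I x0 * norm (z - w)"
    if "set I \<subseteq> D" "z \<in> X" "w \<in> X" "norm (z - w) < \<epsilon>" for I z w
    by (rule word_map_local_lipschitz[where \<epsilon> = \<epsilon>]) (use that dist x0 \<epsilon> in \<open>auto simp: dist_norm\<close>)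
  have "norm (word_map \<phi> I z - word_map \<phi> I w) \<le> C * word_deriv \<phi> I x0 * norm (z - w)"
    if I: "set I \<subseteq> D" and zw: "z \<in> X" "w \<in> X" for I z w
  proof (cases "length I < l")
    case True
    have "norm (word_map \<phi> I z - word_map \<phi> I w) \<le> r ^ length I * norm (z - w)"
      using I zw X_V by (intro word_map_lipschitz) auto
    also have "\<dots> \<le> C * word_deriv \<phi> I x0 * norm (z - w)"
    proof (rule mult_right_mono)
      have "r ^ length I \<le> 1" using r by (intro power_le_one) auto
      also have "1 \<le> K\<^sup>2" using K by simp
      also have "K\<^sup>2 \<le> C * word_deriv \<phi> I x0"
      proof -
        have "lo \<le> 1" using rho lo X_V x0 D_ne by (meson ex_in_conv less_imp_le order_trans subsetD)
        then have "lo ^ l \<le> lo ^ length I" using True lo(1) by (intro power_decreasing) auto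
        also have "\<dots> \<le> word_deriv \<phi> I x0" using I x0 X_V by (intro word_deriv_bounds) auto
        finally have "C * lo ^ l \<le> C * word_deriv \<phi> I x0" using C0 by (intro mult_left_mono) auto
        then show ?thesis using lo(1) by (simp add: C_def)
      qed
      finally show "r ^ length I \<le> C * word_deriv \<phi> I x0" .
    qed simp
    finally show ?thesis .
  next
    case False
    define n where "n = length I - l"
    define J where "J = drop n I"
    define H where "H = take n I"
    have HJ: "I = H @ J" by (simp add: H_def J_def)
    have lJ: "length J = l" using False by (simp add: J_def n_def)
    have s: "set H \<subseteq> D" "set J \<subseteq> D" using I HJ by auto
    have JX: "word_map \<phi> J u \<in> X" if "u \<in> X" for u using s(2) that by (rule word_map_X)
    have J: "norm (word_map \<phi> J z - word_map \<phi> J w) \<le> r ^ l * norm (z - w)"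
      using word_map_lipschitz[OF s(2), of z w] zw X_V lJ by auto
    also have "\<dots> \<le> r ^ l * d" using r d zw by (intro mult_left_mono) auto
    also note rl
    finally have Je: "norm (word_map \<phi> J z - word_map \<phi> J w) < \<epsilon>" .
    have wd: "lo ^ l * word_deriv \<phi> H x0 \<le> K * word_deriv \<phi> I x0"
    proof -
      have "lo ^ l * word_deriv \<phi> H x0 \<le> word_deriv \<phi> J x0 * (K * word_deriv \<phi> H (word_map \<phi> J x0))"
      proof (rule mult_mono)
        show "lo ^ l \<le> word_deriv \<phi> J x0" using word_deriv_bounds(1)[OF s(2), of x0] lJ x0 X_V by auto
        show "word_deriv \<phi> H x0 \<le> K * word_deriv \<phi> H (word_map \<phi> J x0)"
          using dist[OF s(1) JX[OF x0] x0, of x0] \<epsilon> by simp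
        show "0 \<le> word_deriv \<phi> J x0" "0 \<le> word_deriv \<phi> H x0"
          using word_deriv_bounds(3) s x0 X_V by (meson less_imp_le subsetD)+
      qed
      then show ?thesis by (simp add: HJ word_deriv_append mult_ac)
    qed
    have "norm (word_map \<phi> I z - word_map \<phi> I w) = norm (word_map \<phi> H (word_map \<phi> J z) - word_map \<phi> H (word_map \<phi> J w))"
      by (simp add: HJ word_map_append)
    also have "\<dots> \<le> K * word_deriv \<phi> H x0 * norm (word_map \<phi> J z - word_map \<phi> J w)"
      using near[OF s(1) JX JX Je] zw by simp
    also have "\<dots> \<le> K * word_deriv \<phi> H x0 * norm (z - w)"
    proof (rule mult_left_mono)
      have "r ^ l * norm (z - w) \<le> 1 * norm (z - w)" using r by (intro mult_right_mono power_le_one) auto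
      then show "norm (word_map \<phi> J z - word_map \<phi> J w) \<le> norm (z - w)" using J by simp
      show "0 \<le> K * word_deriv \<phi> H x0"
        using K word_deriv_bounds(3)[OF s(1), of x0] x0 X_V by (auto intro!: mult_nonneg_nonneg less_imp_le)
    qed
    also have "\<dots> \<le> C * word_deriv \<phi> I x0 * norm (z - w)"
    proof (rule mult_right_mono)
      have "K * word_deriv \<phi> H x0 * lo ^ l \<le> K * (K * word_deriv \<phi> I x0)"
        using wd K by (simp add: mult_ac)
      then show "K * word_deriv \<phi> H x0 \<le> C * word_deriv \<phi> I x0"
        using lo(1) by (simp add: C_def field_simps power2_eq_square)
    qed simp
    finally show ?thesis .
  qed
  then show thesis using that C0 by blast
qed

section \<open>Norms of words, level sums and the pressure\<close>

lemma word_norm: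
  assumes I: "set I \<subseteq> D"
  shows "word_norm \<phi> V I = (SUP x\<in>V. word_deriv \<phi> I x)" "bdd_above (word_deriv \<phi> I ` V)"
    "word_norm \<phi> V I \<le> \<rho> ^ length I" "0 < word_norm \<phi> V I"
    "\<And>x. x \<in> V \<Longrightarrow> word_deriv \<phi> I x \<le> word_norm \<phi> V I"
proof -
  show eq: "word_norm \<phi> V I = (SUP x\<in>V. word_deriv \<phi> I x)"
    unfolding word_norm_def using deriv_norm_word_map[OF I] by (intro SUP_cong) auto
  show bdd: "bdd_above (word_deriv \<phi> I ` V)"
    using word_deriv_bounds(2)[OF I] by (intro bdd_aboveI[of _ "\<rho> ^ length I"]) auto
  have V: "V \<noteq> {}" using X_ne X_V by blast
  show "word_norm \<phi> V I \<le> \<rho> ^ length I"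
    unfolding eq using V word_deriv_bounds(2)[OF I] by (intro cSUP_least) auto
  show le: "word_deriv \<phi> I x \<le> word_norm \<phi> V I" if "x \<in> V" for x
    unfolding eq using bdd that by (intro cSUP_upper) auto
  obtain x where "x \<in> V" using V by blast
  then show "0 < word_norm \<phi> V I" using le[of x] word_deriv_bounds(3)[OF I, of x] by linarith
qed

lemma word_norm_append:
  assumes "set I \<subseteq> D" "set J \<subseteq> D"
  shows "word_norm \<phi> V (I @ J) \<le> word_norm \<phi> V I * word_norm \<phi> V J"
proof -
  have IJ: "set (I @ J) \<subseteq> D" using assms by simp
  show ?thesis unfolding word_norm(1)[OF IJ]
  proof (rule cSUP_least)
    show "V \<noteq> {}" using X_ne X_V by blast
    fix x assume x: "x \<in> V"
    have "word_deriv \<phi> I (word_map \<phi> J x) * word_deriv \<phi> J x \<le> word_norm \<phi> V I * word_norm \<phi> V J"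
      using assms x by (intro mult_mono word_norm(5) less_imp_le[OF word_deriv_bounds(3)] less_imp_le[OF word_norm(4)] word_map_V)
    then show "word_deriv \<phi> (I @ J) x \<le> word_norm \<phi> V I * word_norm \<phi> V J"
      by (simp add: word_deriv_append)
  qed
qed

definition level_sum :: "real \<Rightarrow> nat \<Rightarrow> real" where
  "level_sum s n = (\<Sum>I\<in>words D n. word_norm \<phi> V I powr s)"

lemma words_ne: "words D n \<noteq> {}"
proof -
  obtain i where "i \<in> D" using D_ne by blast
  then have "replicate n i \<in> words D n" by (auto simp: words_def)
  then show ?thesis by blast
qed

lemma level_sum_pos: "0 < level_sum s n"
  unfolding level_sum_def
  by (intro sum_pos finite_words finite_D words_ne) (metis powr_gt_zero word_norm(4) wordsD(2) less_irrefl)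

lemma word_norm_ge: "set I \<subseteq> D \<Longrightarrow> lo ^ length I \<le> word_norm \<phi> V I"
  using X_ne X_V word_norm(5) word_deriv_bounds(1) by (meson ex_in_conv order_trans subsetD)

lemma level_sum_0: "level_sum s 0 = 1"
proof -
  have "word_norm \<phi> V [] = 1"
    using word_norm(1)[of "[]"] X_ne X_V by (simp add: subset_empty) (metis bot.extremum_uniqueI cSUP_const)
  then show ?thesis by (simp add: level_sum_def)
qed

lemma level_sum_mult:
  assumes "0 \<le> s"
  shows "level_sum s (m + n) \<le> level_sum s m * level_sum s n"
  unfolding level_sum_def sum_words_add[OF finite_D] sum_product
proof (intro sum_mono)
  fix I J assume "I \<in> words D m" "J \<in> words D n"
  then have s: "set I \<subseteq> D" "set J \<subseteq> D" by (auto simp: wordsD)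
  have "word_norm \<phi> V (I @ J) powr s \<le> (word_norm \<phi> V I * word_norm \<phi> V J) powr s"
    using s assms word_norm(4)[of "I @ J"] by (intro powr_mono2 word_norm_append) auto
  also have "\<dots> = word_norm \<phi> V I powr s * word_norm \<phi> V J powr s"
    by (rule powr_mult)
  finally show "word_norm \<phi> V (I @ J) powr s \<le> word_norm \<phi> V I powr s * word_norm \<phi> V J powr s" .
qed

lemma level_sum_mult_neg:
  assumes "s \<le> 0"
  shows "level_sum s m * level_sum s n \<le> level_sum s (m + n)"
  unfolding level_sum_def sum_words_add[OF finite_D] sum_product
proof (intro sum_mono)
  fix I J assume "I \<in> words D m" "J \<in> words D n"
  then have s: "set I \<subseteq> D" "set J \<subseteq> D" by (auto simp: wordsD)
  have "word_norm \<phi> V I powr s * word_norm \<phi> V J powr s = (word_norm \<phi> V I * word_norm \<phi> V J) powr s"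
    by (rule powr_mult[symmetric])
  also have "\<dots> \<le> word_norm \<phi> V (I @ J) powr s"
    using s assms word_norm(4)[of "I @ J"] by (intro powr_mono2' word_norm_append) auto
  finally show "word_norm \<phi> V I powr s * word_norm \<phi> V J powr s \<le> word_norm \<phi> V (I @ J) powr s" .
qed

lemma level_sum_ge:
  assumes "\<And>I. I \<in> words D n \<Longrightarrow> b ^ n \<le> word_norm \<phi> V I powr s"
  shows "b ^ n \<le> level_sum s n"
proof -
  obtain I where I: "I \<in> words D n" using words_ne by blast
  have "b ^ n \<le> word_norm \<phi> V I powr s" by (rule assms[OF I])
  also have "\<dots> \<le> level_sum s n"
    unfolding level_sum_def by (rule member_le_sum[OF I]) (auto simp: finite_words finite_D)
  finally show ?thesis .
qed

lemma pressure_eq: "pressure D \<phi> V s = lim (\<lambda>n. ln (level_sum s n) / real n)"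
  unfolding pressure_def level_sum_def by (simp add: divide_inverse mult.commute)

text \<open>\<open>pressure\<close> is a \<open>lim\<close>, which carries information only once
  convergence is known. For s \<ge> 0 the logarithms of the level sums are subadditive; for s < 0
  \<open>powr\<close> reverses the inequality and their negatives are.\<close>

lemma convergent_pressure: "convergent (\<lambda>n. ln (level_sum s n) / real n)"
proof (cases "0 \<le> s")
  case True
  show ?thesis
  proof (rule subadditive_convergent[where C = "- ln (lo powr s)"])
    show "ln (level_sum s 0) = 0" by (simp add: level_sum_0)
    show "ln (level_sum s (m + n)) \<le> ln (level_sum s m) + ln (level_sum s n)" for m n
    proof -
      have "ln (level_sum s (m + n)) \<le> ln (level_sum s m * level_sum s n)"
        using level_sum_mult[OF True, of m n] level_sum_pos[of s] by (intro ln_mono) auto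
      then show ?thesis using level_sum_pos[of s] by (simp add: ln_mult less_imp_neq[symmetric])
    qed
    show "- (- ln (lo powr s)) * real n \<le> ln (level_sum s n)" for n
    proof -
      have "(lo powr s) ^ n \<le> level_sum s n"
        using lo(1) True
        by (intro level_sum_ge) (auto simp: power_powr[symmetric] dest: word_norm_ge[OF wordsD(2)] wordsD(1) intro!: powr_mono2)
      then have "ln ((lo powr s) ^ n) \<le> ln (level_sum s n)"
        using lo(1) level_sum_pos by (intro ln_mono) auto
      then show ?thesis using lo(1) by (simp add: ln_realpow mult.commute)
    qed
  qed
next
  case False
  define b where "b = real (card D) * lo powr s"
  have b: "0 < b" using lo(1) finite_D D_ne by (simp add: b_def card_gt_0_iff)
  have "convergent (\<lambda>n. - ln (level_sum s n) / real n)"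
  proof (rule subadditive_convergent[where C = "ln b"])
    show "- ln (level_sum s 0) = 0" by (simp add: level_sum_0)
    show "- ln (level_sum s (m + n)) \<le> - ln (level_sum s m) + - ln (level_sum s n)" for m n
    proof -
      have "ln (level_sum s m * level_sum s n) \<le> ln (level_sum s (m + n))"
        using level_sum_mult_neg[of s m n] False level_sum_pos[of s] by (intro ln_mono) auto
      then show ?thesis using level_sum_pos[of s] by (simp add: ln_mult less_imp_neq[symmetric])
    qed
    show "- ln b * real n \<le> - ln (level_sum s n)" for n
    proof -
      have "level_sum s n \<le> (\<Sum>I\<in>words D n. (lo powr s) ^ n)"
        unfolding level_sum_def
        using lo(1) False
        by (intro sum_mono) (auto simp: power_powr[symmetric] dest: word_norm_ge[OF wordsD(2)] wordsD(1) intro!: powr_mono2')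
      also have "\<dots> = b ^ n"
        using card_lists_length_eq[OF finite_D, of n] by (simp add: words_def b_def power_mult_distrib)
      finally have "ln (level_sum s n) \<le> ln (b ^ n)"
        using b level_sum_pos by (intro ln_mono) auto
      then show ?thesis using b by (simp add: ln_realpow mult.commute)
    qed
  qed
  then show ?thesis using convergent_minus_iff by fastforce
qed

lemma pressure_limit: "(\<lambda>n. ln (level_sum s n) / real n) \<longlonglongrightarrow> pressure D \<phi> V s"
  unfolding pressure_eq using convergent_pressure by (simp add: convergent_LIMSEQ_iff)

text \<open>All norms at level n are at most \<rho> ^ n, so a negative exponent would make the level
  sums grow at rate at least \<gamma> * ln \<rho> > 0.\<close>

lemma pressure_zero_nonneg:
  assumes "pressure D \<phi> V \<gamma> = 0"
  shows "0 \<le> \<gamma>"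
proof (rule ccontr)
  assume "\<not> 0 \<le> \<gamma>"
  then have g: "\<gamma> < 0" by simp
  have "(\<rho> powr \<gamma>) ^ n \<le> level_sum \<gamma> n" for n
    using g rho_pos
    by (intro level_sum_ge) (auto simp: power_powr[symmetric] dest: word_norm(3,4)[OF wordsD(2)] wordsD(1) intro!: powr_mono2')
  then have "ln ((\<rho> powr \<gamma>) ^ n) \<le> ln (level_sum \<gamma> n)" for n
    using rho_pos level_sum_pos by (intro ln_mono) auto
  then have le: "\<gamma> * ln \<rho> \<le> ln (level_sum \<gamma> n) / real n" if "1 \<le> n" for n
    using rho_pos that by (simp add: ln_realpow ln_powr field_simps)
  have "\<gamma> * ln \<rho> \<le> pressure D \<phi> V \<gamma>"
    by (rule LIMSEQ_le_const[OF pressure_limit]) (use le in blast)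
  moreover have "0 < \<gamma> * ln \<rho>" using g rho_pos rho(1) by (intro mult_neg_neg) auto
  ultimately show False using assms by simp
qed

section \<open>Weights at a base point\<close>

lemma word_deriv_quasi_mult:
  assumes K: "distortion_const K"
    and x0: "x0 \<in> X" and IJ: "set I \<subseteq> D" "set J \<subseteq> D"
  shows "word_deriv \<phi> (I @ J) x0 \<le> K * word_deriv \<phi> I x0 * word_deriv \<phi> J x0"
    "word_deriv \<phi> I x0 * word_deriv \<phi> J x0 \<le> K * word_deriv \<phi> (I @ J) x0"
proof -
  have y: "word_map \<phi> J x0 \<in> X" using IJ x0 by (intro word_map_X)
  have J: "0 \<le> word_deriv \<phi> J x0" using word_deriv_bounds(3)[OF IJ(2), of x0] x0 X_V by auto
  show "word_deriv \<phi> (I @ J) x0 \<le> K * word_deriv \<phi> I x0 * word_deriv \<phi> J x0"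
    unfolding word_deriv_append by (intro mult_right_mono distortion_constD(2)[OF K] IJ y x0 J)
  show "word_deriv \<phi> I x0 * word_deriv \<phi> J x0 \<le> K * word_deriv \<phi> (I @ J) x0"
    using mult_right_mono[OF distortion_constD(2)[OF K IJ(1) x0 y] J] by (simp add: word_deriv_append mult.assoc)
qed

text \<open>Evaluating at one point of X instead of taking the supremum over V gives
  multiplicativity up to a constant in both directions; for \<open>word_norm\<close> there is only
  the inequality of \<open>word_norm_append\<close>.\<close>

definition weight :: "real \<Rightarrow> 'a \<Rightarrow> 'i list \<Rightarrow> real" where
  "weight s x I = word_deriv \<phi> I x powr s"

lemma weight_quasi_mult:
  assumes K: "distortion_const K"
    and x0: "x0 \<in> X" and IJ: "set I \<subseteq> D" "set J \<subseteq> D" and s: "0 \<le> s"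
  shows "weight s x0 (I @ J) \<le> K powr s * weight s x0 I * weight s x0 J"
    "weight s x0 I * weight s x0 J \<le> K powr s * weight s x0 (I @ J)"
proof -
  note K1 = distortion_constD(1)[OF K]
  have V: "x0 \<in> V" using x0 X_V by blast
  have pos: "0 < word_deriv \<phi> I x0" "0 < word_deriv \<phi> J x0" "0 < word_deriv \<phi> (I @ J) x0"
    using IJ V by (auto intro!: word_deriv_bounds(3))
  note q = word_deriv_quasi_mult[OF K x0 IJ]
  show "weight s x0 (I @ J) \<le> K powr s * weight s x0 I * weight s x0 J"
    using powr_mono2[OF s less_imp_le[OF pos(3)] q(1)] pos K1 by (simp add: weight_def powr_mult)
  show "weight s x0 I * weight s x0 J \<le> K powr s * weight s x0 (I @ J)"
    using powr_mono2[OF s _ q(2)] pos K1 by (simp add: weight_def powr_mult)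
qed

text \<open>If one level sum a n of the weights exceeded M = K powr \<gamma>, then
  \<open>mult\<close> would yield a (k * n) \<ge> (a n / M) ^ k. As a is dominated by the level sums
  of the norms, the pressure would be positive.\<close>

lemma weight_sum_upper:
  assumes K: "distortion_const K"
    and x0: "x0 \<in> X" and P: "pressure D \<phi> V \<gamma> = 0"
  shows "(\<Sum>I\<in>words D n. weight \<gamma> x0 I) \<le> K powr \<gamma>"
proof (rule ccontr)
  note K1 = distortion_constD(1)[OF K]
  define a where "a n = (\<Sum>I\<in>words D n. weight \<gamma> x0 I)" for n
  define M where "M = K powr \<gamma>"
  have g: "0 \<le> \<gamma>" by (rule pressure_zero_nonneg[OF P])
  have M1: "1 \<le> M" using g K1 by (simp add: M_def ge_one_powr_ge_zero)
  have a0: "a 0 = 1" by (simp add: a_def weight_def)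
  assume "\<not> (\<Sum>I\<in>words D n. weight \<gamma> x0 I) \<le> K powr \<gamma>"
  then have n: "M < a n" by (simp add: a_def M_def)
  then have n1: "1 \<le> n" using a0 M1 by (cases n) auto
  have mult: "a k * a m \<le> M * a (k + m)" for k m
  proof -
    have "a k * a m = (\<Sum>I\<in>words D k. \<Sum>J\<in>words D m. weight \<gamma> x0 I * weight \<gamma> x0 J)"
      unfolding a_def by (rule sum_product)
    also have "\<dots> \<le> (\<Sum>I\<in>words D k. \<Sum>J\<in>words D m. M * weight \<gamma> x0 (I @ J))"
      unfolding M_def
      using x0 g by (intro sum_mono weight_quasi_mult(2)[OF K]) (auto simp: wordsD)
    also have "\<dots> = M * a (k + m)"
      unfolding a_def sum_words_add[OF finite_D] by (simp add: sum_distrib_left)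
    finally show ?thesis .
  qed
  have pw: "(a n / M) ^ k \<le> a (k * n)" for k
  proof (induction k)
    case (Suc k)
    have "(a n / M) ^ k * a n \<le> a (k * n) * a n" using Suc n M1 by (intro mult_right_mono) auto
    also have "\<dots> \<le> M * a (k * n + n)" by (rule mult)
    finally show ?case using M1 by (simp add: field_simps)
  qed (simp add: a0)
  have aA: "a j \<le> level_sum \<gamma> j" for j
    unfolding a_def level_sum_def weight_def
  proof (intro sum_mono powr_mono2 g)
    fix I assume "I \<in> words D j"
    then have "set I \<subseteq> D" by (rule wordsD)
    then show "0 \<le> word_deriv \<phi> I x0" "word_deriv \<phi> I x0 \<le> word_norm \<phi> V I"
      using x0 X_V word_norm(5)[of I x0] word_deriv_bounds(3)[of I x0] by (auto simp: less_imp_le)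
  qed
  have low: "ln (a n / M) / real n \<le> ln (level_sum \<gamma> (k * n)) / real (k * n)" if "1 \<le> k" for k
  proof -
    have "ln ((a n / M) ^ k) \<le> ln (level_sum \<gamma> (k * n))"
      using n M1 level_sum_pos order_trans[OF pw aA] by (intro ln_mono) auto
    then have "real k * ln (a n / M) \<le> ln (level_sum \<gamma> (k * n))"
      using n M1 by (simp add: ln_realpow)
    then show ?thesis using that n1 by (simp add: field_simps)
  qed
  have "strict_mono (\<lambda>k. k * n)" using n1 by (simp add: strict_mono_def)
  then have "(\<lambda>k. ln (level_sum \<gamma> (k * n)) / real (k * n)) \<longlonglongrightarrow> 0"
    using LIMSEQ_subseq_LIMSEQ[OF pressure_limit, of "\<lambda>k. k * n" \<gamma>] by (simp add: P comp_def)
  then have "ln (a n / M) / real n \<le> 0"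
    by (rule LIMSEQ_le_const) (use low in blast)
  moreover have "0 < ln (a n / M)" using n M1 by (intro ln_gt_zero) auto
  ultimately show False using n1 by (simp add: divide_le_0_iff)
qed

section \<open>Recurrence\<close>

text \<open>This makes the \<open>THE\<close> in \<open>coding_map\<close> meaningful. Letters after
  the n-th move the image by at most r ^ n * diameter Y, so the sequence is Cauchy and its limit is
  the same for every y. Starting in X keeps the limit in the closed set X.\<close>

lemma coding_map_limit:
  assumes \<omega>: "\<And>m. \<omega> m \<in> D"
  shows "coding_map \<phi> Y \<omega> \<in> X"
    "y \<in> Y \<Longrightarrow> (\<lambda>n. word_map \<phi> (map \<omega> [0..<n]) y) \<longlonglongrightarrow> coding_map \<phi> Y \<omega>"
proof -
  define d where "d = diameter Y"
  have d: "norm (z - w) \<le> d" if "z \<in> Y" "w \<in> Y" for z w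
    unfolding d_def using that diameter_bounded_bound[OF compact_imp_bounded[OF compact_Y]] by (simp add: dist_norm)
  have s: "set (map \<omega> l) \<subseteq> D" for l using \<omega> by auto
  obtain x0 where x0: "x0 \<in> X" using X_ne by blast
  have x0Y: "x0 \<in> Y" using x0 X_Y by blast
  define z where "z n = word_map \<phi> (map \<omega> [0..<n]) x0" for n
  have near: "norm (word_map \<phi> (map \<omega> [0..<n]) y - z m) \<le> r ^ n * d" if "n \<le> m" "y \<in> Y" for n m y
  proof -
    have e: "z m = word_map \<phi> (map \<omega> [0..<n]) (word_map \<phi> (map \<omega> [n..<m]) x0)"
      using upt_add_eq_append[of 0 n "m - n"] that by (simp add: z_def word_map_append)
    have Y: "word_map \<phi> (map \<omega> [n..<m]) x0 \<in> Y" using s x0Y by (rule word_map_Y)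
    have "norm (word_map \<phi> (map \<omega> [0..<n]) y - z m) \<le> r ^ n * norm (y - word_map \<phi> (map \<omega> [n..<m]) x0)"
      unfolding e using word_map_lipschitz[OF s, of y _ "[0..<n]"] that(2) Y Y_V by auto
    also have "\<dots> \<le> r ^ n * d" using r d that(2) Y by (intro mult_left_mono) auto
    finally show ?thesis .
  qed
  have lim0: "(\<lambda>n. r ^ n * d) \<longlonglongrightarrow> 0" using r by (intro tendsto_mult_left_zero LIMSEQ_power_zero) auto
  have "Cauchy z"
  proof (rule metric_CauchyI)
    fix e :: real assume "0 < e"
    then have "\<forall>\<^sub>F n in sequentially. r ^ n * d < e / 2" using lim0 by (intro order_tendstoD) auto
    then obtain N where N: "r ^ N * d < e / 2" unfolding eventually_sequentially by blast
    have "dist (z N) (z m) < e / 2" if "N \<le> m" for m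
      using near[OF that x0Y] N by (simp add: z_def dist_norm)
    then show "\<exists>M. \<forall>m\<ge>M. \<forall>n\<ge>M. dist (z m) (z n) < e"
      by (intro exI[of _ N]) (metis dist_triangle_half_r)
  qed
  then obtain x where x: "z \<longlonglongrightarrow> x" using Cauchy_convergent convergent_def by blast
  have zX: "z n \<in> X" for n unfolding z_def using s x0 by (rule word_map_X)
  have xX: "x \<in> X"
    using closed_sequentially[OF compact_imp_closed[OF compact_X] _ x] zX by blast
  have lim: "(\<lambda>n. word_map \<phi> (map \<omega> [0..<n]) y) \<longlonglongrightarrow> x" if "y \<in> Y" for y
  proof -
    have "(\<lambda>n. word_map \<phi> (map \<omega> [0..<n]) y - z n) \<longlonglongrightarrow> 0"
      using lim0 by (rule Lim_null_comparison[rotated]) (use near that in auto)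
    from tendsto_add[OF this x] show ?thesis by simp
  qed
  have "coding_map \<phi> Y \<omega> = x"
    unfolding coding_map_def using lim x0Y by (intro the_equality) (auto intro: LIMSEQ_unique)
  then show "coding_map \<phi> Y \<omega> \<in> X" "y \<in> Y \<Longrightarrow> (\<lambda>n. word_map \<phi> (map \<omega> [0..<n]) y) \<longlonglongrightarrow> coding_map \<phi> Y \<omega>"
    using xX lim by auto
qed

lemma coding_map_shift:
  assumes \<omega>: "\<And>m. \<omega> m \<in> D"
  shows "coding_map \<phi> Y \<omega> = \<phi> (\<omega> 0) (coding_map \<phi> Y (\<lambda>m. \<omega> (Suc m)))"
proof -
  let ?x = "coding_map \<phi> Y (\<lambda>m. \<omega> (Suc m))"
  obtain y where y: "y \<in> Y" using X_ne X_Y by blast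
  have "?x \<in> V" using coding_map_limit(1)[of "\<lambda>m. \<omega> (Suc m)"] \<omega> X_V by blast
  then have "isCont (\<phi> (\<omega> 0)) ?x"
    using deriv[OF \<omega>] has_derivative_continuous by blast
  moreover have "(\<lambda>n. word_map \<phi> (map (\<lambda>m. \<omega> (Suc m)) [0..<n]) y) \<longlonglongrightarrow> ?x"
    using \<omega> y by (intro coding_map_limit)
  ultimately have "(\<lambda>n. \<phi> (\<omega> 0) (word_map \<phi> (map (\<lambda>m. \<omega> (Suc m)) [0..<n]) y)) \<longlonglongrightarrow> \<phi> (\<omega> 0) ?x"
    by (rule isCont_tendsto_compose)
  moreover have "\<phi> (\<omega> 0) (word_map \<phi> (map (\<lambda>m. \<omega> (Suc m)) [0..<n]) y) = word_map \<phi> (map \<omega> [0..<Suc n]) y" for n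
    by (simp add: upt_conv_Cons map_Suc_upt[symmetric] comp_def del: upt_Suc)
  ultimately have "(\<lambda>n. word_map \<phi> (map \<omega> [0..<Suc n]) y) \<longlonglongrightarrow> \<phi> (\<omega> 0) ?x" by (simp only:)
  from LIMSEQ_unique[OF LIMSEQ_Suc[OF coding_map_limit(2)[of \<omega>, OF \<omega> y]] this] show ?thesis .
qed

text \<open>The codings of \<open>x\<close> and \<open>T x\<close> chosen by the map may be unrelated, but their first letters
  along an orbit assemble to a coding on which \<open>T\<close> acts exactly as the shift.\<close>

definition itinerary :: "('a \<Rightarrow> 'i) \<Rightarrow> ('a \<Rightarrow> 'a) \<Rightarrow> nat \<Rightarrow> 'a \<Rightarrow> 'i list" where
  "itinerary \<iota> T n x = map (\<lambda>k. \<iota> ((T ^^ k) x)) [0..<n]"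

text \<open>Only the first letter of each chosen coding is kept: it names a map under which T x is a
  preimage of x. The later arguments about orbits rest on this relation alone.\<close>

lemma induced_by_shift_branch:
  assumes "induced_by_shift D \<phi> Y X T"
  shows "\<exists>\<iota>. \<forall>x\<in>X. \<iota> x \<in> D \<and> T x \<in> X \<and> \<phi> (\<iota> x) (T x) = x"
proof -
  obtain \<kappa> where \<kappa>: "\<And>x. x \<in> X \<Longrightarrow> is_coding D \<phi> Y (\<kappa> x) x"
    "\<And>x. x \<in> X \<Longrightarrow> T x = coding_map \<phi> Y (\<lambda>m. \<kappa> x (Suc m))"
    using assms unfolding induced_by_shift_def by blast
  show ?thesis
  proof (intro exI[of _ "\<lambda>x. \<kappa> x 0"] ballI conjI)
    fix x assume x: "x \<in> X"
    have D: "\<kappa> x m \<in> D" for m using \<kappa>(1)[OF x] by (simp add: is_coding_def)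
    show "\<kappa> x 0 \<in> D" by (rule D)
    show "T x \<in> X" unfolding \<kappa>(2)[OF x] by (rule coding_map_limit(1)) (rule D)
    show "\<phi> (\<kappa> x 0) (T x) = x"
      using coding_map_shift[of "\<kappa> x"] D \<kappa>(1)[OF x] unfolding \<kappa>(2)[OF x] by (simp add: is_coding_def)
  qed
qed

context
  fixes \<iota> :: "'a \<Rightarrow> 'i" and T :: "'a \<Rightarrow> 'a"
  assumes branch: "\<forall>x\<in>X. \<iota> x \<in> D \<and> T x \<in> X \<and> \<phi> (\<iota> x) (T x) = x"
begin

lemma T_pow_X: "x \<in> X \<Longrightarrow> (T ^^ n) x \<in> X"
  by (induction n) (use branch in auto)

lemma itinerary_words: "x \<in> X \<Longrightarrow> itinerary \<iota> T n x \<in> words D n"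
  using branch T_pow_X by (fastforce simp: itinerary_def words_def)

lemma word_map_itinerary: "x \<in> X \<Longrightarrow> word_map \<phi> (itinerary \<iota> T n x) ((T ^^ n) x) = x"
proof (induction n)
  case (Suc n)
  then show ?case using branch T_pow_X[OF Suc.prems, of n]
    by (simp add: itinerary_def word_map_append)
qed (simp add: itinerary_def)

lemma take_itinerary: "k \<le> n \<Longrightarrow> take k (itinerary \<iota> T n x) = itinerary \<iota> T k x"
  by (simp add: itinerary_def take_map)

text \<open>Translates a hit at time n into a common initial itinerary of x and its n-th
  image.\<close>

lemma take_drop_itinerary:
  assumes "n + k \<le> L"
  shows "take k (drop n (itinerary \<iota> T L x)) = itinerary \<iota> T k ((T ^^ n) x)"
proof -
  have "(T ^^ (n + i)) x = (T ^^ i) ((T ^^ n) x)" for i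
    using funpow_add[of i n T] by (simp add: add.commute)
  then show ?thesis using assms by (intro nth_equalityI) (auto simp: itinerary_def)
qed

end

text \<open>Cylinders of level L have diameter at most C * d * \<rho> ^ L, which determines L0;
  their diameters to the power \<gamma> are at most a constant times their weights.\<close>

lemma content_cylinders:
  assumes "0 < \<gamma>" and x0: "x0 \<in> X" and "0 < \<delta>"
  obtains C L0 where "0 < C" "\<And>L W A. L0 \<le> L \<Longrightarrow> W \<subseteq> words D L \<Longrightarrow> A \<subseteq> (\<Union>I\<in>W. word_map \<phi> I ` X)
    \<Longrightarrow> hausdorff_content \<delta> \<gamma> A \<le> ennreal (C * sum (weight \<gamma> x0) W)"
proof -
  obtain C where C: "0 < C" "\<And>I z w. set I \<subseteq> D \<Longrightarrow> z \<in> X \<Longrightarrow> w \<in> X \<Longrightarrow>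
      norm (word_map \<phi> I z - word_map \<phi> I w) \<le> C * word_deriv \<phi> I x0 * norm (z - w)"
    by (rule word_map_bound_X[OF x0]) (rule that)
  \<comment> \<open>The added 1 keeps d positive when X is a single point.\<close>
  define d where "d = diameter X + 1"
  have d: "norm (z - w) \<le> d" if "z \<in> X" "w \<in> X" for z w
    unfolding d_def using that diameter_bounded_bound[OF compact_imp_bounded[OF compact_X], of z w] by (simp add: dist_norm)
  have d0: "0 < d" unfolding d_def using diameter_ge_0[OF compact_imp_bounded[OF compact_X]] by simp
  have V: "x0 \<in> V" using x0 X_V by blast
  obtain L0 where L0: "\<rho> ^ L0 < \<delta> / (C * d)"
    using real_arch_pow_inv[of "\<delta> / (C * d)" \<rho>] rho assms C d0 by auto
  show thesis
  proof (rule that[of "(C * d) powr \<gamma>" L0])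
    show "0 < (C * d) powr \<gamma>" using C d0 by simp
    fix L W A assume L: "L0 \<le> L" and W: "W \<subseteq> words D L" and A: "A \<subseteq> (\<Union>I\<in>W. word_map \<phi> I ` X)"
    have fW: "finite W" using W finite_words[OF finite_D] by (rule finite_subset)
    have "hausdorff_content \<delta> \<gamma> A \<le> hausdorff_content \<delta> \<gamma> (\<Union>I\<in>W. word_map \<phi> I ` X)"
      by (rule hausdorff_content_mono[OF A])
    also have "\<dots> \<le> (\<Sum>I\<in>W. hausdorff_content \<delta> \<gamma> (word_map \<phi> I ` X))"
      using assms by (intro hausdorff_content_UN_finite fW) auto
    also have "\<dots> \<le> (\<Sum>I\<in>W. ennreal ((C * d) powr \<gamma> * weight \<gamma> x0 I))"
    proof (rule sum_mono)
      fix I assume "I \<in> W"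
      then have I: "I \<in> words D L" using W by blast
      then have s: "set I \<subseteq> D" "length I = L" by (auto simp: wordsD)
      note b = word_deriv_bounds[OF s(1) V]
      have "hausdorff_content \<delta> \<gamma> (word_map \<phi> I ` X) \<le> ennreal ((C * d * word_deriv \<phi> I x0) powr \<gamma>)"
      proof (rule hausdorff_content_le_powr)
        fix x y assume "x \<in> word_map \<phi> I ` X" "y \<in> word_map \<phi> I ` X"
        then obtain z w where zw: "z \<in> X" "w \<in> X" "x = word_map \<phi> I z" "y = word_map \<phi> I w" by blast
        have "dist x y \<le> C * word_deriv \<phi> I x0 * norm (z - w)"
          using C(2)[OF s(1) zw(1,2)] zw by (simp add: dist_norm)
        also have "\<dots> \<le> C * word_deriv \<phi> I x0 * d"
          using C(1) b(3) d zw by (intro mult_left_mono) auto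
        finally show "dist x y \<le> C * d * word_deriv \<phi> I x0" by (simp add: mult_ac)
      next
        show "0 \<le> C * d * word_deriv \<phi> I x0" using C(1) d0 b(3) by simp
        have "word_deriv \<phi> I x0 \<le> \<rho> ^ L" using b(2) s by simp
        also have "\<dots> \<le> \<rho> ^ L0" using L rho rho_pos by (intro power_decreasing) auto
        finally have "C * d * word_deriv \<phi> I x0 \<le> C * d * \<rho> ^ L0"
          using C(1) d0 by (intro mult_left_mono) auto
        also have "\<dots> \<le> \<delta>" using L0 C(1) d0 by (simp add: field_simps)
        finally show "C * d * word_deriv \<phi> I x0 \<le> \<delta>" .
      qed (use assms in simp)
      then show "hausdorff_content \<delta> \<gamma> (word_map \<phi> I ` X) \<le> ennreal ((C * d) powr \<gamma> * weight \<gamma> x0 I)"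
        using C(1) d0 b(3) by (simp add: powr_mult weight_def)
    qed
    also have "\<dots> = ennreal ((C * d) powr \<gamma> * sum (weight \<gamma> x0) W)"
      by (subst sum_ennreal) (auto simp: sum_distrib_left weight_def)
    finally show "hausdorff_content \<delta> \<gamma> A \<le> ennreal ((C * d) powr \<gamma> * sum (weight \<gamma> x0) W)" .
  qed
qed

section \<open>The convergence case\<close>

lemma recurrence_set_null:
  assumes P: "pressure D \<phi> V \<gamma> = 0" and g: "0 < \<gamma>" and T: "induced_by_shift D \<phi> Y X T"
    and \<psi>: "\<And>n. 1 \<le> n \<Longrightarrow> 0 < \<psi> n" and sum: "summable (\<lambda>n. \<psi> (Suc n) powr \<gamma>)"
  shows "hausdorff_measure \<gamma> (recurrence_set X T \<psi>) = 0"
proof (rule hausdorff_measure_zeroI)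
  fix \<delta> \<epsilon> :: real assume \<delta>: "0 < \<delta>" and \<epsilon>: "0 < \<epsilon>"
  obtain \<iota> where \<iota>: "\<forall>x\<in>X. \<iota> x \<in> D \<and> T x \<in> X \<and> \<phi> (\<iota> x) (T x) = x"
    using induced_by_shift_branch[OF T] ..
  note it = itinerary_words[OF \<iota>] word_map_itinerary[OF \<iota>] T_pow_X[OF \<iota>]
  obtain x0 where x0: "x0 \<in> X" using X_ne by blast
  then have V: "x0 \<in> V" using X_V by blast
  obtain K where K: "distortion_const K" using ex_distortion_const ..
  note K1 = distortion_constD(1)[OF K]
  obtain C where C: "0 < C" "\<And>I z w. set I \<subseteq> D \<Longrightarrow> z \<in> X \<Longrightarrow> w \<in> X \<Longrightarrow>
      norm (word_map \<phi> I z - word_map \<phi> I w) \<le> C * word_deriv \<phi> I x0 * norm (z - w)"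
    by (rule word_map_bound_X[OF x0]) (rule that)
  \<comment> \<open>The factor 2 / (1 - r) bounds the distance of two points z, w that the same word
    moves by less than \<psi> n: the word contracts |z - w| by r at least, so (1 - r) * |z - w|
    \<le> 2 * \<psi> n.\<close>
  define c where "c = C * (2 / (1 - r))"
  have c0: "0 < c" using C(1) r by (simp add: c_def)
  define M where "M = c powr \<gamma> * K powr \<gamma>"
  have M0: "0 < M" using c0 K1 by (simp add: M_def)
  define Z where "Z n = {x\<in>X. norm ((T ^^ n) x - x) < \<psi> n}" for n
  have Z: "hausdorff_content \<delta> \<gamma> (Z n) \<le> ennreal (M * \<psi> n powr \<gamma>)" if n: "1 \<le> n" and small: "c * \<psi> n \<le> \<delta>" for n
  proof -
    define U where "U I = word_map \<phi> I ` {z\<in>X. norm (z - word_map \<phi> I z) < \<psi> n}" for I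
    have "Z n \<subseteq> (\<Union>I\<in>words D n. U I)"
    proof
      fix x assume "x \<in> Z n"
      then have x: "x \<in> X" "norm ((T ^^ n) x - x) < \<psi> n" by (auto simp: Z_def)
      then have "x \<in> U (itinerary \<iota> T n x)"
        unfolding U_def using it(2)[of x n] it(3)[of x n] by (intro image_eqI[of _ _ "(T ^^ n) x"]) auto
      then show "x \<in> (\<Union>I\<in>words D n. U I)" using it(1)[OF x(1)] by blast
    qed
    then have "hausdorff_content \<delta> \<gamma> (Z n) \<le> hausdorff_content \<delta> \<gamma> (\<Union>I\<in>words D n. U I)"
      by (rule hausdorff_content_mono)
    also have "\<dots> \<le> (\<Sum>I\<in>words D n. hausdorff_content \<delta> \<gamma> (U I))"
      using \<delta> by (intro hausdorff_content_UN_finite finite_words finite_D) auto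
    also have "\<dots> \<le> (\<Sum>I\<in>words D n. ennreal (c powr \<gamma> * \<psi> n powr \<gamma> * weight \<gamma> x0 I))"
    proof (rule sum_mono)
      fix I assume I: "I \<in> words D n"
      then have s: "set I \<subseteq> D" "length I = n" by (auto simp: wordsD)
      note b = word_deriv_bounds[OF s(1) V]
      have "hausdorff_content \<delta> \<gamma> (U I) \<le> ennreal ((c * \<psi> n * word_deriv \<phi> I x0) powr \<gamma>)"
      proof (rule hausdorff_content_le_powr)
        fix x y assume "x \<in> U I" "y \<in> U I"
        then obtain z w where zw: "z \<in> X" "w \<in> X" "x = word_map \<phi> I z" "y = word_map \<phi> I w"
          "norm (z - x) < \<psi> n" "norm (w - y) < \<psi> n" unfolding U_def by blast
        have "norm (x - y) \<le> r ^ n * norm (z - w)"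
          using word_map_lipschitz[OF s(1), of z w] s zw X_V by auto
        also have "\<dots> \<le> r * norm (z - w)"
          using r n power_decreasing[of 1 n r] by (intro mult_right_mono) auto
        finally have "norm (x - y) \<le> r * norm (z - w)" .
        moreover have "norm (z - w) \<le> norm (z - x) + norm (x - y) + norm (w - y)"
          using norm_triangle_ineq[of "z - x" "x - w"] norm_triangle_ineq[of "x - y" "y - w"]
          by (simp add: norm_minus_commute)
        ultimately have "(1 - r) * norm (z - w) \<le> 2 * \<psi> n" using zw(5,6) by (simp add: algebra_simps)
        then have nzw: "norm (z - w) \<le> 2 / (1 - r) * \<psi> n" using r by (simp add: field_simps)
        have "dist x y \<le> C * word_deriv \<phi> I x0 * norm (z - w)"
          using C(2)[OF s(1) zw(1,2)] zw by (simp add: dist_norm)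
        also have "\<dots> \<le> C * word_deriv \<phi> I x0 * (2 / (1 - r) * \<psi> n)"
          using C(1) b(3) nzw by (intro mult_left_mono) auto
        finally show "dist x y \<le> c * \<psi> n * word_deriv \<phi> I x0" by (simp add: c_def mult_ac)
      next
        show "0 \<le> c * \<psi> n * word_deriv \<phi> I x0" using c0 \<psi>[OF n] b(3) by simp
        have "word_deriv \<phi> I x0 \<le> 1"
          using b(2) s rho(1) rho_pos power_le_one[of \<rho> n] by (auto intro: order_trans)
        then have "c * \<psi> n * word_deriv \<phi> I x0 \<le> c * \<psi> n * 1"
          using c0 \<psi>[OF n] by (intro mult_left_mono) auto
        then show "c * \<psi> n * word_deriv \<phi> I x0 \<le> \<delta>" using small by simp
      qed (use g in simp)
      then show "hausdorff_content \<delta> \<gamma> (U I) \<le> ennreal (c powr \<gamma> * \<psi> n powr \<gamma> * weight \<gamma> x0 I)"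
        using c0 \<psi>[OF n] b(3) by (simp add: powr_mult weight_def)
    qed
    also have "\<dots> = ennreal (c powr \<gamma> * \<psi> n powr \<gamma> * (\<Sum>I\<in>words D n. weight \<gamma> x0 I))"
      by (subst sum_ennreal) (auto simp: sum_distrib_left weight_def)
    also have "\<dots> \<le> ennreal (c powr \<gamma> * \<psi> n powr \<gamma> * K powr \<gamma>)"
      using weight_sum_upper[OF K x0 P, of n] by (intro ennreal_leI mult_left_mono) auto
    finally show ?thesis by (simp add: M_def mult_ac)
  qed
  \<comment> \<open>The terms of the series tend to zero, so from some index on the sets covering Z
    n respect the scale \<delta>.\<close>
  have ev1: "\<forall>\<^sub>F n in sequentially. \<psi> (Suc n) powr \<gamma> < (\<delta> / c) powr \<gamma>"
    using summable_LIMSEQ_zero[OF sum] \<delta> c0 by (intro order_tendstoD) auto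
  then obtain N1 where N1: "\<And>n. N1 \<le> n \<Longrightarrow> \<psi> (Suc n) powr \<gamma> < (\<delta> / c) powr \<gamma>"
    unfolding eventually_sequentially by blast
  have small: "c * \<psi> (Suc n) \<le> \<delta>" if "N1 \<le> n" for n
  proof (rule ccontr)
    assume "\<not> c * \<psi> (Suc n) \<le> \<delta>"
    then have "\<delta> / c \<le> \<psi> (Suc n)" using c0 by (simp add: field_simps)
    then have "(\<delta> / c) powr \<gamma> \<le> \<psi> (Suc n) powr \<gamma>" using g \<delta> c0 by (intro powr_mono2) auto
    then show False using N1[OF that] by simp
  qed
  obtain N2 where N2: "\<And>n. N2 \<le> n \<Longrightarrow> norm (\<Sum>i. \<psi> (Suc (i + n)) powr \<gamma>) < \<epsilon> / M"
    using suminf_exist_split[of "\<epsilon> / M", OF _ sum] \<epsilon> M0 by auto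
  define N where "N = max N1 N2"
  have "recurrence_set X T \<psi> \<subseteq> (\<Union>i. Z (Suc (i + N)))"
  proof
    fix x assume x: "x \<in> recurrence_set X T \<psi>"
    then have "infinite {n. 1 \<le> n \<and> norm ((T ^^ n) x - x) < \<psi> n}" by (simp add: recurrence_set_def)
    then obtain n where n: "N < n" "norm ((T ^^ n) x - x) < \<psi> n"
      unfolding infinite_nat_iff_unbounded by blast
    then have "x \<in> Z (Suc ((n - Suc N) + N))" using x by (simp add: Z_def recurrence_set_def)
    then show "x \<in> (\<Union>i. Z (Suc (i + N)))" by blast
  qed
  then have "hausdorff_content \<delta> \<gamma> (recurrence_set X T \<psi>) \<le> hausdorff_content \<delta> \<gamma> (\<Union>i. Z (Suc (i + N)))"
    by (rule hausdorff_content_mono)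
  also have "\<dots> \<le> (\<Sum>i. hausdorff_content \<delta> \<gamma> (Z (Suc (i + N))))" by (rule hausdorff_content_Union)
  also have "\<dots> \<le> (\<Sum>i. ennreal (M * \<psi> (Suc (i + N)) powr \<gamma>))"
    by (intro suminf_le Z small) (auto simp: N_def)
  also have "\<dots> = ennreal (\<Sum>i. M * \<psi> (Suc (i + N)) powr \<gamma>)"
  proof (rule suminf_ennreal2)
    show "summable (\<lambda>i. M * \<psi> (Suc (i + N)) powr \<gamma>)"
      using summable_ignore_initial_segment[OF sum, of N] by (intro summable_mult) simp
  qed (use M0 in auto)
  also have "\<dots> = ennreal (M * (\<Sum>i. \<psi> (Suc (i + N)) powr \<gamma>))"
    using summable_ignore_initial_segment[OF sum, of N] by (subst suminf_mult) auto
  also have "\<dots> \<le> ennreal \<epsilon>"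
  proof (rule ennreal_leI)
    have "(\<Sum>i. \<psi> (Suc (i + N)) powr \<gamma>) \<le> \<epsilon> / M" using N2[of N] by (simp add: N_def)
    then show "M * (\<Sum>i. \<psi> (Suc (i + N)) powr \<gamma>) \<le> \<epsilon>" using M0 by (simp add: field_simps)
  qed
  finally show "hausdorff_content \<delta> \<gamma> (recurrence_set X T \<psi>) \<le> ennreal \<epsilon>" .
qed

section \<open>The divergence case\<close>

lemma hausdorff_measure_zero_of_small_level:
  assumes g: "0 < \<gamma>" and x0: "x0 \<in> X"
    and K: "distortion_const K"
    and small: "K powr \<gamma> * (\<Sum>I\<in>words D n. weight \<gamma> x0 I) < 1"
  shows "hausdorff_measure \<gamma> X = 0"
proof (rule hausdorff_measure_zeroI)
  note K1 = distortion_constD(1)[OF K]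
  fix \<delta> \<epsilon> :: real assume \<delta>: "0 < \<delta>" and \<epsilon>: "0 < \<epsilon>"
  define a where "a n = (\<Sum>I\<in>words D n. weight \<gamma> x0 I)" for n
  define M where "M = K powr \<gamma>"
  have M1: "1 \<le> M" using g K1 by (simp add: M_def ge_one_powr_ge_zero)
  have a0: "a 0 = 1" by (simp add: a_def weight_def)
  have ann: "0 \<le> a k" for k unfolding a_def by (intro sum_nonneg) (simp add: weight_def)
  have n: "M * a n < 1" using small by (simp add: a_def M_def)
  then have n1: "1 \<le> n" using a0 M1 by (cases n) auto
  have mult: "a (k + m) \<le> M * a k * a m" for k m
  proof -
    have "a (k + m) \<le> (\<Sum>I\<in>words D k. \<Sum>J\<in>words D m. M * weight \<gamma> x0 I * weight \<gamma> x0 J)"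
      unfolding a_def sum_words_add[OF finite_D] M_def
      using x0 g by (intro sum_mono weight_quasi_mult(1)[OF K]) (auto simp: wordsD)
    also have "\<dots> = M * (\<Sum>I\<in>words D k. \<Sum>J\<in>words D m. weight \<gamma> x0 I * weight \<gamma> x0 J)"
      by (simp add: sum_distrib_left mult.assoc)
    also have "\<dots> = M * (a k * a m)" unfolding a_def sum_product ..
    finally show ?thesis by simp
  qed
  \<comment> \<open>One small level sum forces geometric decay along the multiples of n, with ratio
    M * a n < 1; the cylinders of each of these levels cover X.\<close>
  have pw: "a (k * n) \<le> (M * a n) ^ k" for k
  proof (induction k)
    case (Suc k)
    have "a (Suc k * n) \<le> (M * a n) * a (k * n)" using mult[of n "k * n"] by simp
    also have "\<dots> \<le> (M * a n) * (M * a n) ^ k" using Suc M1 ann[of n] by (intro mult_left_mono) auto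
    finally show ?case by simp
  qed (simp add: a0)
  obtain C L0 where C: "0 < C" "\<And>L W A. L0 \<le> L \<Longrightarrow> W \<subseteq> words D L \<Longrightarrow> A \<subseteq> (\<Union>I\<in>W. word_map \<phi> I ` X)
    \<Longrightarrow> hausdorff_content \<delta> \<gamma> A \<le> ennreal (C * sum (weight \<gamma> x0) W)"
    by (rule content_cylinders[OF g x0 \<delta>]) (rule that)
  have "(\<lambda>k. (M * a n) ^ k) \<longlonglongrightarrow> 0" using n M1 ann[of n] by (intro LIMSEQ_power_zero) auto
  then have "\<forall>\<^sub>F k in sequentially. (M * a n) ^ k < \<epsilon> / C" using \<epsilon> C(1) by (intro order_tendstoD) auto
  then obtain k where k: "L0 \<le> k" "(M * a n) ^ k < \<epsilon> / C"
    unfolding eventually_sequentially by (meson linear order_refl)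
  have "L0 \<le> k * n" using k n1 by (metis le_trans mult.right_neutral mult_le_mono2)
  then have "hausdorff_content \<delta> \<gamma> X \<le> ennreal (C * a (k * n))"
    unfolding a_def using X_words[of "k * n"] by (intro C(2)) auto
  also have "\<dots> \<le> ennreal \<epsilon>"
    using order_le_less_trans[OF pw k(2)] C(1) by (intro ennreal_leI) (simp add: field_simps)
  finally show "hausdorff_content \<delta> \<gamma> X \<le> ennreal \<epsilon>" .
qed

text \<open>Zero pressure supplies the upper mass bound, the hypothesis \<open>big\<close> the lower
  one; \<gamma> > 0 makes the decay rate \<rho> powr \<gamma> smaller than 1.\<close>

lemma gibbs_words_weight:
  assumes g: "0 < \<gamma>" and x0: "x0 \<in> X"
    and K: "distortion_const K"
    and P: "pressure D \<phi> V \<gamma> = 0"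
    and big: "\<And>n. 1 \<le> K powr \<gamma> * (\<Sum>I\<in>words D n. weight \<gamma> x0 I)"
  shows "gibbs_words D (weight \<gamma> x0) (K powr \<gamma>) (K powr \<gamma>) (\<rho> powr \<gamma>) (lo powr \<gamma>)"
proof
  note K1 = distortion_constD(1)[OF K]
  have V: "x0 \<in> V" using x0 X_V by blast
  show "finite D" by (rule finite_D)
  show "weight \<gamma> x0 [] = 1" by (simp add: weight_def)
  show "0 < weight \<gamma> x0 I" if "set I \<subseteq> D" for I
    using word_deriv_bounds(3)[OF that V] by (simp add: weight_def)
  show "weight \<gamma> x0 (I @ J) \<le> K powr \<gamma> * weight \<gamma> x0 I * weight \<gamma> x0 J" if "set I \<subseteq> D" "set J \<subseteq> D" for I J
    using x0 that g by (intro weight_quasi_mult[OF K]) auto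
  show "weight \<gamma> x0 I * weight \<gamma> x0 J \<le> K powr \<gamma> * weight \<gamma> x0 (I @ J)" if "set I \<subseteq> D" "set J \<subseteq> D" for I J
    using x0 that g by (intro weight_quasi_mult[OF K]) auto
  show "weight \<gamma> x0 I \<le> (\<rho> powr \<gamma>) ^ length I" if "set I \<subseteq> D" for I
    using word_deriv_bounds[OF that V] g rho_pos
    by (auto simp: weight_def power_powr[symmetric] intro!: powr_mono2)
  show "0 < \<rho> powr \<gamma>" "\<rho> powr \<gamma> < 1" "0 < lo powr \<gamma>"
    using rho_pos rho(1) g lo(1) powr_less_mono2[of \<gamma> \<rho> 1] by auto
  show "lo powr \<gamma> \<le> weight \<gamma> x0 [i]" if "i \<in> D" for i
    using lo(1) lo(2)[OF that V] g by (auto simp: weight_def intro!: powr_mono2)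
  show "1 \<le> K powr \<gamma>" using g K1 by (simp add: ge_one_powr_ge_zero)
  show "(\<Sum>I\<in>words D n. weight \<gamma> x0 I) \<le> K powr \<gamma>" for n by (rule weight_sum_upper[OF K x0 P])
  show "1 \<le> K powr \<gamma> * (\<Sum>I\<in>words D n. weight \<gamma> x0 I)" for n by (rule big)
qed

lemma recurrence_set_full_measure:
  assumes P: "pressure D \<phi> V \<gamma> = 0" and g: "0 < \<gamma>" and T: "induced_by_shift D \<phi> Y X T"
    and \<psi>: "\<And>n. 1 \<le> n \<Longrightarrow> 0 < \<psi> n" and div: "\<not> summable (\<lambda>n. \<psi> (Suc n) powr \<gamma>)"
  shows "hausdorff_measure \<gamma> (recurrence_set X T \<psi>) = hausdorff_measure \<gamma> X"
proof -
  obtain \<iota> where \<iota>: "\<forall>x\<in>X. \<iota> x \<in> D \<and> T x \<in> X \<and> \<phi> (\<iota> x) (T x) = x"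
    using induced_by_shift_branch[OF T] ..
  note it = itinerary_words[OF \<iota>] word_map_itinerary[OF \<iota>] T_pow_X[OF \<iota>]
    take_itinerary[OF \<iota>] take_drop_itinerary[OF \<iota>]
  obtain x0 where x0: "x0 \<in> X" using X_ne by blast
  then have V: "x0 \<in> V" using X_V by blast
  obtain K where K: "distortion_const K" using ex_distortion_const ..
  note K1 = distortion_constD(1)[OF K]
  have sub: "recurrence_set X T \<psi> \<subseteq> X" by (auto simp: recurrence_set_def)
  show ?thesis
  proof (cases "\<exists>n. K powr \<gamma> * (\<Sum>I\<in>words D n. weight \<gamma> x0 I) < 1")
    case True
    then have "hausdorff_measure \<gamma> X = 0"
      using hausdorff_measure_zero_of_small_level[OF g x0 K] by blast
    then show ?thesis using hausdorff_measure_mono[OF sub, of \<gamma>] by simp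
  next
    case False
    interpret gibbs_words D "weight \<gamma> x0" "K powr \<gamma>" "K powr \<gamma>" "\<rho> powr \<gamma>" "lo powr \<gamma>"
      by (rule gibbs_words_weight[OF g x0 K P]) (use False in \<open>simp add: not_less\<close>)
    obtain C where C: "0 < C" "\<And>I z w. set I \<subseteq> D \<Longrightarrow> z \<in> X \<Longrightarrow> w \<in> X \<Longrightarrow>
        norm (word_map \<phi> I z - word_map \<phi> I w) \<le> C * word_deriv \<phi> I x0 * norm (z - w)"
      by (rule word_map_bound_X[OF x0]) (rule that)
    \<comment> \<open>The bound d exceeds all distances in X strictly, which yields the strict
      inequality demanded by \<open>recurrence_set\<close>.\<close>
    define d where "d = diameter X + 1"
    have d: "norm (z - w) < d" if "z \<in> X" "w \<in> X" for z w
      unfolding d_def using that diameter_bounded_bound[OF compact_imp_bounded[OF compact_X], of z w] by (simp add: dist_norm)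
    have d0: "0 < d" unfolding d_def using diameter_ge_0[OF compact_imp_bounded[OF compact_X]] by simp
    \<comment> \<open>Weight at most \<open>(\<psi> n / (C * d)) powr \<gamma>\<close> means
      derivative at most \<open>\<psi> n / (C * d)\<close>, hence a cylinder in which distances stay
      below \<psi> n. The minimum secures p n \<le> 1, and n = 0 gets the value 1 since \<psi> 0
      need not be positive.\<close>
    define p where "p n = (if n = 0 then 1 else min 1 ((\<psi> n / (C * d)) powr \<gamma>))" for n
    have p01: "0 < p n" "p n \<le> 1" for n using \<psi>[of n] C(1) d0 by (auto simp: p_def)
    \<comment> \<open>A summable p would tend to zero, so the truncation at 1 would be inactive from
      some index on.\<close>
    have pdiv: "\<not> summable p"
    proof
      assume p: "summable p"
      then have "p \<longlonglongrightarrow> 0" by (rule summable_LIMSEQ_zero)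
      then have "\<forall>\<^sub>F n in sequentially. p n < 1" by (intro order_tendstoD) auto
      then have ev: "\<forall>\<^sub>F n in sequentially. p n = (\<psi> n / (C * d)) powr \<gamma>"
        by (rule eventually_mono) (auto simp: p_def min_def split: if_splits)
      have "summable (\<lambda>n. (\<psi> n / (C * d)) powr \<gamma>)"
        using p summable_cong[OF ev] by simp
      then have "summable (\<lambda>n. (\<psi> (Suc n) / (C * d)) powr \<gamma>)" by (subst summable_Suc_iff)
      then have "summable (\<lambda>n. (C * d) powr \<gamma> * (\<psi> (Suc n) / (C * d)) powr \<gamma>)" by (rule summable_mult)
      moreover have "(C * d) powr \<gamma> * (\<psi> (Suc n) / (C * d)) powr \<gamma> = \<psi> (Suc n) powr \<gamma>" for n
        using \<psi>[of "Suc n"] C(1) d0 by (subst powr_mult[symmetric]) auto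
      ultimately show False using div by simp
    qed
    define Z where "Z N = {x\<in>X. \<forall>n\<ge>N. \<psi> n \<le> norm ((T ^^ n) x - x)}" for N
    have Z: "hausdorff_measure \<gamma> (Z N) = 0" for N
    proof (rule hausdorff_measure_zeroI)
      fix \<delta> \<epsilon> :: real assume \<delta>: "0 < \<delta>" and \<epsilon>: "0 < \<epsilon>"
      obtain C' L0 where C': "0 < C'" "\<And>L W A. L0 \<le> L \<Longrightarrow> W \<subseteq> words D L \<Longrightarrow> A \<subseteq> (\<Union>I\<in>W. word_map \<phi> I ` X)
        \<Longrightarrow> hausdorff_content \<delta> \<gamma> A \<le> ennreal (C' * sum (weight \<gamma> x0) W)"
        by (rule content_cylinders[OF g x0 \<delta>]) (rule that)
      \<comment> \<open>The three lower bounds give, in this order, \<psi> n > 0, the distance bound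
        defining Z N at time n, and a level deep enough for the scale \<delta>.\<close>
      define N' where "N' = max 1 (max N L0)"
      obtain L where L: "N' \<le> L" and sm: "sum (weight \<gamma> x0) {w \<in> words D L. \<forall>n\<in>admissible p.
          N' \<le> n \<and> 2 * n \<le> L \<longrightarrow> \<not> hit p n w} \<le> \<epsilon> / C'"
        using never_hit_mass[OF p01 pdiv, of "\<epsilon> / C'" N'] \<epsilon> C'(1) by auto
      define W where "W = {w \<in> words D L. \<forall>n\<in>admissible p. N' \<le> n \<and> 2 * n \<le> L \<longrightarrow> \<not> hit p n w}"
      have "Z N \<subseteq> (\<Union>I\<in>W. word_map \<phi> I ` X)"
      proof
        fix x assume "x \<in> Z N"
        then have x: "x \<in> X" and far: "\<And>n. N \<le> n \<Longrightarrow> \<psi> n \<le> norm ((T ^^ n) x - x)" by (auto simp: Z_def)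
        define w where "w = itinerary \<iota> T L x"
        have w: "w \<in> words D L" unfolding w_def by (rule it(1)[OF x])
        have "\<not> hit p n w" if n: "n \<in> admissible p" "N' \<le> n" "2 * n \<le> L" for n
        proof
          assume hit: "hit p n w"
          define v where "v = stop (p n) w"
          have n1: "1 \<le> n" "N \<le> n" "n \<le> L" using n by (auto simp: N'_def)
          note st = stop[OF w n1(3) p01, of n, folded v_def]
          have adm: "(\<rho> powr \<gamma>) ^ n \<le> p n" using n by (simp add: admissible_def)
          note st = st[OF adm]
          \<comment> \<open>A hit makes v the initial itinerary of both x and its n-th image, so
            both are images of points of X under the same \<open>word_map \<phi> v\<close>.\<close>
          have v1: "v = itinerary \<iota> T (length v) x"
            using st(1,2) n1 it(4)[of "length v" L x] by (simp add: w_def)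
          have v2: "v = itinerary \<iota> T (length v) ((T ^^ n) x)"
            using hit[unfolded hit_def, folded v_def] st(1) n it(5)[of n "length v" L x] by (simp add: w_def)
          define y z where "y = (T ^^ length v) x" and "z = (T ^^ length v) ((T ^^ n) x)"
          have yz: "y \<in> X" "z \<in> X" unfolding y_def z_def using it(3) x by auto
          have xy: "x = word_map \<phi> v y" "(T ^^ n) x = word_map \<phi> v z"
            using it(2)[of x "length v"] it(2)[of "(T ^^ n) x" "length v"] it(3)[OF x] v1 v2 x
            unfolding y_def z_def by auto
          have vD: "set v \<subseteq> D" using st(3) by (simp add: wordsD)
          have "weight \<gamma> x0 v \<le> (\<psi> n / (C * d)) powr \<gamma>" using st(4) n1 by (simp add: p_def)
          then have "word_deriv \<phi> v x0 \<le> \<psi> n / (C * d)"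
            unfolding weight_def using g powr_less_mono2[OF g, of "\<psi> n / (C * d)" "word_deriv \<phi> v x0"]
              \<psi>[OF n1(1)] C(1) d0 by (meson divide_nonneg_pos less_imp_le mult_pos_pos not_less)
          then have le: "C * word_deriv \<phi> v x0 * d \<le> \<psi> n" using C(1) d0 by (simp add: field_simps)
          have "norm ((T ^^ n) x - x) \<le> C * word_deriv \<phi> v x0 * norm (z - y)"
            using C(2)[OF vD yz(2,1)] xy by simp
          also have "\<dots> < C * word_deriv \<phi> v x0 * d"
            using C(1) word_deriv_bounds(3)[OF vD V] d[OF yz(2,1)] by (intro mult_strict_left_mono) auto
          finally show False using le far[OF n1(2)] by simp
        qed
        then have "w \<in> W" using w by (auto simp: W_def)
        moreover have "x \<in> word_map \<phi> w ` X"
          using it(2)[OF x, of L] it(3)[OF x, of L] unfolding w_def by (intro image_eqI) auto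
        ultimately show "x \<in> (\<Union>I\<in>W. word_map \<phi> I ` X)" by blast
      qed
      then have "hausdorff_content \<delta> \<gamma> (Z N) \<le> ennreal (C' * sum (weight \<gamma> x0) W)"
        using L by (intro C'(2)[of L]) (auto simp: N'_def W_def)
      also have "\<dots> \<le> ennreal \<epsilon>"
        using sm C'(1) unfolding W_def by (intro ennreal_leI) (auto simp: field_simps)
      finally show "hausdorff_content \<delta> \<gamma> (Z N) \<le> ennreal \<epsilon>" .
    qed
    have "X \<subseteq> recurrence_set X T \<psi> \<union> (\<Union>N. Z N)"
    proof
      fix x assume x: "x \<in> X"
      show "x \<in> recurrence_set X T \<psi> \<union> (\<Union>N. Z N)"
      proof (cases "x \<in> recurrence_set X T \<psi>")
        case False
        then have "finite {n. 1 \<le> n \<and> norm ((T ^^ n) x - x) < \<psi> n}" using x by (simp add: recurrence_set_def)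
        then obtain N where N: "\<forall>n\<in>{n. 1 \<le> n \<and> norm ((T ^^ n) x - x) < \<psi> n}. n \<le> N"
          unfolding finite_nat_set_iff_bounded_le by (elim exE)
        have "\<psi> n \<le> norm ((T ^^ n) x - x)" if "Suc N \<le> n" for n
          using bspec[OF N, of n] that by (cases "\<psi> n \<le> norm ((T ^^ n) x - x)") auto
        then have "x \<in> Z (Suc N)" unfolding Z_def using x by blast
        then show ?thesis by blast
      qed simp
    qed
    then have "hausdorff_measure \<gamma> X \<le> hausdorff_measure \<gamma> (recurrence_set X T \<psi> \<union> (\<Union>N. Z N))"
      by (rule hausdorff_measure_mono)
    also have "\<dots> \<le> hausdorff_measure \<gamma> (recurrence_set X T \<psi>) + hausdorff_measure \<gamma> (\<Union>N. Z N)"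
      by (rule hausdorff_measure_Un)
    also have "hausdorff_measure \<gamma> (\<Union>N. Z N) = 0"
      using hausdorff_measure_Union[of \<gamma> Z] by (simp add: Z)
    finally show ?thesis using hausdorff_measure_mono[OF sub, of \<gamma>] by (simp add: antisym)
  qed
qed

text \<open>For \<gamma> = 0 the weights count words, and \<open>weight_sum_upper\<close> allows
  only one of length 1, so D has a single letter. The invariant set of a single contraction is a
  point, which T fixes.\<close>

lemma recurrence_set_zero_dim:
  assumes P: "pressure D \<phi> V 0 = 0" and T: "induced_by_shift D \<phi> Y X T"
    and \<psi>: "\<And>n. 1 \<le> n \<Longrightarrow> 0 < \<psi> n"
  shows "recurrence_set X T \<psi> = X"
proof -
  obtain \<iota> where \<iota>: "\<forall>x\<in>X. \<iota> x \<in> D \<and> T x \<in> X \<and> \<phi> (\<iota> x) (T x) = x"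
    using induced_by_shift_branch[OF T] ..
  obtain x0 where x0: "x0 \<in> X" using X_ne by blast
  obtain K where K: "distortion_const K" using ex_distortion_const ..
  note K1 = distortion_constD(1)[OF K]
  have "card (words D 1) \<le> 1"
  proof -
    have "(\<Sum>I\<in>words D 1. weight 0 x0 I) = (\<Sum>I\<in>words D 1. 1)"
    proof (rule sum.cong)
      fix I assume "I \<in> words D 1"
      then have "0 < word_deriv \<phi> I x0" using x0 X_V by (intro word_deriv_bounds(3)) (auto simp: wordsD)
      then show "weight 0 x0 I = 1" by (simp add: weight_def)
    qed simp
    then show ?thesis using weight_sum_upper[OF K x0 P, of 1] K1 by simp
  qed
  then have "card D \<le> 1" using card_lists_length_eq[OF finite_D, of 1] by (simp add: words_def)
  then have D1: "i = j" if "i \<in> D" "j \<in> D" for i j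
    using that finite_D by (metis card_le_Suc0_iff_eq One_nat_def)
  have "y = z" if yz: "y \<in> X" "z \<in> X" for y z
  proof -
    \<comment> \<open>A pair realising the diameter of X: both points are images of points of X
      under the one map, so their distance is at most r times itself.\<close>
    obtain a b where ab: "a \<in> X" "b \<in> X" "\<And>x y. x \<in> X \<Longrightarrow> y \<in> X \<Longrightarrow> dist x y \<le> dist a b"
      using compact_sup_maxdistance[OF compact_X X_ne] by (auto simp: dist_norm)
    have "\<phi> (\<iota> a) (T a) = a" "\<phi> (\<iota> a) (T b) = b" using \<iota> ab(1,2) D1[of "\<iota> a" "\<iota> b"] by metis+
    then have "dist a b \<le> r * dist (T a) (T b)"
      using lipschitz[of "\<iota> a" "T a" "T b"] \<iota> ab X_V by (auto simp: dist_norm)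
    also have "\<dots> \<le> r * dist a b" using r ab \<iota> by (intro mult_left_mono) auto
    finally have "(1 - r) * dist a b \<le> 0" by (simp add: algebra_simps)
    then have "dist a b \<le> 0" using r by (simp add: mult_le_0_iff)
    then show "y = z" using ab(3)[OF yz] by (metis dist_le_zero_iff order_trans)
  qed
  then have "(T ^^ n) x = x" if "x \<in> X" for x n using T_pow_X[OF \<iota>] that by blast
  then have "{n. 1 \<le> n \<and> norm ((T ^^ n) x - x) < \<psi> n} = {1..}" if "x \<in> X" for x
    using that \<psi> by auto
  then show ?thesis by (auto simp: recurrence_set_def infinite_Ici)
qed

end

section \<open>From the definitions to uniform constants\<close>

lemma finite_uniform_less:
  fixes P :: "'i \<Rightarrow> real \<Rightarrow> bool"
  assumes "finite D" "\<And>i. i \<in> D \<Longrightarrow> \<exists>s<b. P i s" "\<And>i s t. i \<in> D \<Longrightarrow> P i s \<Longrightarrow> s \<le> t \<Longrightarrow> P i t"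
  shows "\<exists>t<b. \<forall>i\<in>D. P i t"
proof -
  have "\<forall>i\<in>D. \<exists>s. s < b \<and> P i s" using assms(2) by blast
  then obtain f where f: "\<forall>i\<in>D. f i < b \<and> P i (f i)" using bchoice[of D "\<lambda>i s. s < b \<and> P i s"] by blast
  \<comment> \<open>The element b - 1 keeps the set non-empty when D is empty, without reaching
    b.\<close>
  define t where "t = Max (insert (b - 1) (f ` D))"
  have "t < b" unfolding t_def using assms(1) f by (subst Max_less_iff) auto
  moreover have "P i t" if "i \<in> D" for i
  proof (rule assms(3)[OF that])
    show "P i (f i)" using f that by blast
    show "f i \<le> t" unfolding t_def using assms(1) that by (intro Max_ge) auto
  qed
  ultimately show ?thesis by blast
qed

lemma conformal_ifs_imp_cifs:
  assumes ifs: "conformal_ifs D \<phi> Y V" and X: "self_conformal_set D \<phi> Y X"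
  shows "\<exists>r \<rho> lo \<alpha> c. cifs D \<phi> Y V X r \<rho> lo \<alpha> c"
proof -
  note ifs' = ifs[unfolded conformal_ifs_def]
  have fin: "finite D" and YV: "compact Y" "open V" "Y \<subseteq> V" "\<forall>i\<in>D. \<phi> i ` Y \<subseteq> Y"
    using ifs' by iprover+
  have i: "\<forall>i\<in>D. \<phi> i ` V \<subseteq> V \<and> inj_on (\<phi> i) V \<and> conformal_on V (\<phi> i) \<and> contraction_on V (\<phi> i) \<and>
        bdd_above (deriv_norm (\<phi> i) ` V) \<and>
        0 < (INF x\<in>V. deriv_norm (\<phi> i) x) \<and> (SUP x\<in>V. deriv_norm (\<phi> i) x) < 1"
    using ifs' by (elim conjE)
  have maps: "\<And>i. i \<in> D \<Longrightarrow> \<phi> i ` V \<subseteq> V"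
    and conf: "\<And>i. i \<in> D \<Longrightarrow> conformal_on V (\<phi> i)" and contr: "\<And>i. i \<in> D \<Longrightarrow> contraction_on V (\<phi> i)"
    and bdd: "\<And>i. i \<in> D \<Longrightarrow> bdd_above (deriv_norm (\<phi> i) ` V)"
    and INF: "\<And>i. i \<in> D \<Longrightarrow> 0 < (INF x\<in>V. deriv_norm (\<phi> i) x)"
    and SUP: "\<And>i. i \<in> D \<Longrightarrow> (SUP x\<in>V. deriv_norm (\<phi> i) x) < 1"
    using i by simp_all
  have "\<exists>\<alpha> c. 0 < \<alpha> \<and> 0 < c \<and> (\<forall>i\<in>D. \<forall>x\<in>V. \<forall>y\<in>V.
      \<bar>deriv_norm (\<phi> i) x - deriv_norm (\<phi> i) y\<bar> \<le> c * norm (x - y) powr \<alpha>)"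
    using ifs' by (elim conjE)
  then obtain \<alpha> c where hol: "0 < \<alpha>" "0 < c" "\<forall>i\<in>D. \<forall>x\<in>V. \<forall>y\<in>V.
      \<bar>deriv_norm (\<phi> i) x - deriv_norm (\<phi> i) y\<bar> \<le> c * norm (x - y) powr \<alpha>"
    by (elim exE conjE)
  have der: "\<exists>F. (\<phi> i has_derivative F) (at x) \<and> (\<forall>v. norm (F v) = deriv_norm (\<phi> i) x * norm v)"
    if i: "i \<in> D" and x: "x \<in> V" for i x
  proof -
    obtain F where F: "(\<phi> i has_derivative F) (at x)"
      using conf[OF i] x unfolding conformal_on_def C1_on_def by blast
    moreover have "F = frechet_derivative (\<phi> i) (at x)" by (rule frechet_derivative_at[OF F])
    ultimately show ?thesis using conf[OF i] x unfolding conformal_on_def by blast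
  qed
  have dn0: "0 \<le> deriv_norm (\<phi> i) x" if "i \<in> D" "x \<in> V" for i x
    using der[OF that] nonempty_Basis by (metis ex_in_conv norm_Basis norm_ge_zero mult.right_neutral)
  \<comment> \<open>Lower bounds are negated because \<open>finite_uniform_less\<close> replaces the
    constants of the single letters by their maximum.\<close>
  have l1: "\<exists>s<0. \<forall>x\<in>V. - s \<le> deriv_norm (\<phi> i) x" if "i \<in> D" for i
  proof -
    have "bdd_below (deriv_norm (\<phi> i) ` V)" using dn0[OF that] by (intro bdd_belowI[of _ 0]) auto
    then have "(INF x\<in>V. deriv_norm (\<phi> i) x) \<le> deriv_norm (\<phi> i) x" if "x \<in> V" for x
      using that by (intro cINF_lower)
    then show ?thesis using INF[OF that] by (intro exI[of _ "- (INF x\<in>V. deriv_norm (\<phi> i) x)"]) auto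
  qed
  have "\<exists>l<0. \<forall>i\<in>D. \<forall>x\<in>V. - l \<le> deriv_norm (\<phi> i) x"
    by (rule finite_uniform_less[OF fin l1]) (auto intro: order_trans[rotated])
  then obtain l where l: "l < 0" "\<forall>i\<in>D. \<forall>x\<in>V. - l \<le> deriv_norm (\<phi> i) x" by blast
  have r1: "\<exists>s<1. \<forall>x\<in>V. deriv_norm (\<phi> i) x \<le> s" if "i \<in> D" for i
    using SUP[OF that] bdd[OF that] by (intro exI[of _ "SUP x\<in>V. deriv_norm (\<phi> i) x"]) (auto intro: cSUP_upper)
  have "\<exists>\<rho><1. \<forall>i\<in>D. \<forall>x\<in>V. deriv_norm (\<phi> i) x \<le> \<rho>"
    by (rule finite_uniform_less[OF fin r1]) (auto intro: order_trans)
  then obtain \<rho> where \<rho>: "\<rho> < 1" "\<forall>i\<in>D. \<forall>x\<in>V. deriv_norm (\<phi> i) x \<le> \<rho>" by blast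
  have c1: "\<exists>s<1. 0 < s \<and> (\<forall>x\<in>V. \<forall>y\<in>V. dist (\<phi> i x) (\<phi> i y) \<le> s * dist x y)" if "i \<in> D" for i
    using contr[OF that] unfolding contraction_on_def by blast
  have "\<exists>r<1. \<forall>i\<in>D. 0 < r \<and> (\<forall>x\<in>V. \<forall>y\<in>V. dist (\<phi> i x) (\<phi> i y) \<le> r * dist x y)"
  proof (rule finite_uniform_less[OF fin c1])
    fix i and s t :: real
    assume s: "0 < s \<and> (\<forall>x\<in>V. \<forall>y\<in>V. dist (\<phi> i x) (\<phi> i y) \<le> s * dist x y)" and st: "s \<le> t"
    have "dist (\<phi> i x) (\<phi> i y) \<le> t * dist x y" if "x \<in> V" "y \<in> V" for x y
      using s that mult_right_mono[OF st zero_le_dist, of x y] by fastforce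
    then show "0 < t \<and> (\<forall>x\<in>V. \<forall>y\<in>V. dist (\<phi> i x) (\<phi> i y) \<le> t * dist x y)" using s st by auto
  qed
  then obtain r where r: "r < 1" "\<forall>i\<in>D. 0 < r \<and> (\<forall>x\<in>V. \<forall>y\<in>V. dist (\<phi> i x) (\<phi> i y) \<le> r * dist x y)" by blast
  have Xs: "X \<noteq> {}" "compact X" "X \<subseteq> Y" "X = (\<Union>i\<in>D. \<phi> i ` X)"
    using X unfolding self_conformal_set_def by iprover+
  have "D \<noteq> {}"
  proof
    assume "D = {}"
    then show False using Xs(1,4) by simp
  qed
  then have r0: "0 < r" using r(2) by auto
  have "cifs D \<phi> Y V X r \<rho> (- l) \<alpha> c"
  proof
    show "\<phi> i x \<in> Y" if "i \<in> D" "x \<in> Y" for i x using YV(4) that by auto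
    show "\<phi> i x \<in> V" if "i \<in> D" "x \<in> V" for i x using maps that by auto
    show "norm (\<phi> i x - \<phi> i y) \<le> r * norm (x - y)" if "i \<in> D" "x \<in> V" "y \<in> V" for i x y
      using r(2) that by (simp add: dist_norm)
    show "- l \<le> deriv_norm (\<phi> i) x" "deriv_norm (\<phi> i) x \<le> \<rho>" if "i \<in> D" "x \<in> V" for i x
      using l(2) \<rho>(2) that by auto
    show "0 < - l" using l(1) by simp
    show "\<bar>deriv_norm (\<phi> i) x - deriv_norm (\<phi> i) y\<bar> \<le> c * norm (x - y) powr \<alpha>"
      if "i \<in> D" "x \<in> V" "y \<in> V" for i x y using hol(3) that by blast
  qed (fact fin YV Xs hol r0 r \<rho> der)+
  then show ?thesis by blast
qed

theorem theorem1p3: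
  fixes D :: "'i set"
    and \<phi> :: "'i \<Rightarrow> real ^ 'd \<Rightarrow> real ^ 'd"
    and Y V X :: "(real ^ 'd) set"
    and T :: "real ^ 'd \<Rightarrow> real ^ 'd"
    and \<gamma> :: real
    and \<psi> :: "nat \<Rightarrow> real"
  assumes "conformal_ifs D \<phi> Y V"
    and "self_conformal_set D \<phi> Y X"
    and "pressure D \<phi> V \<gamma> = 0"
    and "induced_by_shift D \<phi> Y X T"
    and "\<And>n. n \<ge> 1 \<Longrightarrow> \<psi> n > 0"
  shows "(summable (\<lambda>n. \<psi> (Suc n) powr \<gamma>) \<longrightarrow>
            hausdorff_measure \<gamma> (recurrence_set X T \<psi>) = 0) \<and>
         (open_set_condition D \<phi> V \<and> \<not> summable (\<lambda>n. \<psi> (Suc n) powr \<gamma>) \<longrightarrow>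
            hausdorff_measure \<gamma> (recurrence_set X T \<psi>) = hausdorff_measure \<gamma> X)"
proof -
  obtain r \<rho> lo \<alpha> c where "cifs D \<phi> Y V X r \<rho> lo \<alpha> c"
    using conformal_ifs_imp_cifs[OF assms(1,2)] by blast
  then interpret cifs D \<phi> Y V X r \<rho> lo \<alpha> c .
  show ?thesis
  proof (cases "\<gamma> = 0")
    \<comment> \<open>Here Hausdorff measure counts points and the decay rate of the weights
      degenerates to 1. The general argument is replaced by a direct one: the series of ones
      diverges and every point of X is recurrent.\<close>
    case True
    have "\<psi> (Suc n) powr \<gamma> = 1" for n using assms(5)[of "Suc n"] True by simp
    then have "\<not> summable (\<lambda>n. \<psi> (Suc n) powr \<gamma>)"
      by (simp add: summable_const_iff)
    moreover have "recurrence_set X T \<psi> = X"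
      using assms(3-5) True by (intro recurrence_set_zero_dim) auto
    ultimately show ?thesis by simp
  next
    case False
    then have "0 < \<gamma>" using pressure_zero_nonneg[OF assms(3)] by simp
    then show ?thesis using recurrence_set_null recurrence_set_full_measure assms(3-5) by blast
  qed
qed

end
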